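(* Let $k\ge1$ and let $\mathbf q=(q_1,\dots,q_{2k+3})$ be a configuration of points in convex position in $\mathbb{R}^2$. The following are equivalent: (1) The rows of $C_{2k}(\mathbf q)$ realize $\overline{\Delta}_k(2k+3)$ as a complete fan. (2) For every octahedral $k$-triangulation $T$ of the $(2k+3)$-gon, the (open) big half-planes defined by the three edges not in $T$ have non-empty intersection. (3) The (open) big half-planes of all the relevant edges have non-empty common intersection.
   Context: Let $n=2k+3$. An edge is an element of $\binom{[n]}{2}$. Two disjoint edges $\{i,j\},\{a,b\}$ with $i<j$, $a<b$ cross if $i<a<j<b$ or $a<i<b<j$. The length of $\{i,j\}$ is $\min\{|j-i|,n-|j-i|\}$; relevant edges are those of length at least $k+1$, i.e. the edges $\{a,a+k+1\}$ (indices mod $n$). A $k$-triangulation is an inclusion-maximal subset of $\binom{[n]}{2}$ containing no $k+1$ pairwise crossing edges. $\overline{\Delta}_k(n)$ is the simplicial complex whose vertices are the relevant edges and whose faces are the sets of relevant edges containing no $k+1$ pairwise crossing edges; it is a sphere of dimension $k(n-2k-1)-1=2k-1$. Every $k$-triangulation of the $(2k+3)$-gon is the complete graph $K_{2k+3}$ minus three relevant edges; it is octahedral if these three missing edges have six distinct endpoints. Convex position: $q_1,\dots,q_n$ are the distinct vertices of a convex $n$-gon, in this cyclic order. For a relevant edge $\{a,b\}$, the line through $q_a,q_b$ leaves $k$ of the remaining points on one side and $k+1$ on the other; the big half-plane of the edge is the open half-plane containing $k+1$ points. $C_d(\mathbf q)$ has one row per edge $\{i,j\}$, $i<j$, and one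 block of $d$ columns per vertex; with $q_i=(x_i,y_i)$, the row of $\{i,j\}$ has $\mathbf c_{ij}$ in block $i$, $-\mathbf c_{ij}$ in block $j$, zeros elsewhere, where $\mathbf c_{ij}=\big((x_i-x_j)^{d-1},(y_i-y_j)(x_i-x_j)^{d-2},\dots,(y_i-y_j)^{d-1}\big)$. Realizing as a complete fan: let $(v_e)_{e\in\binom{[n]}{2}}$ be vectors, $W$ their linear span, $W'$ the quotient of $W$ by the span of the $v_e$ with $e$ of length at most $k$, and $\bar v_e$ the image of $v_e$ in $W'$. The vectors realize $\overline{\Delta}_k(n)$ as a complete fan if $\dim W'=k(n-2k-1)$ and the cones $\operatorname{cone}(\bar v_e:e\in F)$, $F\in\overline{\Delta}_k(n)$, form a complete simplicial fan in $W'$ (for each face $F$ the vectors $\{\bar v_e\}_{e\in F}$ are linearly independent; cones of faces $F,G$ intersect exactly in the cone of $F\cap G$; the cones cover $W'$). *)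

theory Defs
  imports "HOL-Analysis.Analysis" "HOL-Analysis.Finite_Function_Topology"
begin

text \<open>The vertices of the \<open>n\<close>-gon are \<open>1, \<dots>, n\<close> and edges are two-element sets of vertices.\<close>

definition all_edges :: "nat \<Rightarrow> nat set set" where
  "all_edges n = {e. e \<subseteq> {1..n} \<and> card e = 2}"

definition crosses :: "nat set \<Rightarrow> nat set \<Rightarrow> bool" where
  "crosses e f \<longleftrightarrow> (\<exists>i j a b. e = {i, j} \<and> f = {a, b} \<and> i < j \<and> a < b \<and>
     (i < a \<and> a < j \<and> j < b \<or> a < i \<and> i < b \<and> b < j))"

definition edge_length :: "nat \<Rightarrow> nat set \<Rightarrow> nat" where
  "edge_length n e = min (Max e - Min e) (n - (Max e - Min e))"

definition relevant_edges :: "nat \<Rightarrow> nat \<Rightarrow> nat set set" where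
  "relevant_edges k n = {e \<in> all_edges n. k + 1 \<le> edge_length n e}"

definition short_edges :: "nat \<Rightarrow> nat \<Rightarrow> nat set set" where
  "short_edges k n = {e \<in> all_edges n. edge_length n e \<le> k}"

definition crossing_free :: "nat \<Rightarrow> nat set set \<Rightarrow> bool" where
  "crossing_free k E \<longleftrightarrow> \<not> (\<exists>S \<subseteq> E. card S = k + 1 \<and> pairwise crosses S)"

definition k_triangulation :: "nat \<Rightarrow> nat \<Rightarrow> nat set set \<Rightarrow> bool" where
  "k_triangulation k n T \<longleftrightarrow> T \<subseteq> all_edges n \<and> crossing_free k T \<and>
     (\<forall>T'. T \<subseteq> T' \<and> T' \<subseteq> all_edges n \<and> crossing_free k T' \<longrightarrow> T' = T)"

text \<open>The faces of the reduced complex \<open>\<Delta>\<close>-bar; the empty face is included.\<close>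

definition reduced_complex :: "nat \<Rightarrow> nat \<Rightarrow> nat set set set" where
  "reduced_complex k n = {F. F \<subseteq> relevant_edges k n \<and> crossing_free k F}"

text \<open>A \<open>k\<close>-triangulation of the \<open>(2k+3)\<close>-gon misses exactly three edges, all of them relevant.\<close>

definition octahedral :: "nat \<Rightarrow> nat set set \<Rightarrow> bool" where
  "octahedral k T \<longleftrightarrow> k_triangulation k (2*k+3) T \<and>
     card (\<Union> (all_edges (2*k+3) - T)) = 6"

text \<open>
  \<open>q 1, \<dots>, q n\<close> are the distinct vertices of a convex \<open>n\<close>-gon, and cyclically consecutive ones
  span its edges. Both orientations of the polygon are allowed. Values of \<open>q\<close> outside
  \<open>{1..n}\<close> are irrelevant.
\<close>

definition convex_position :: "nat \<Rightarrow> (nat \<Rightarrow> real \<times> real) \<Rightarrow> bool" where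
  "convex_position n q \<longleftrightarrow> inj_on q {1..n} \<and>
     {x. x extreme_point_of (convex hull (q ` {1..n}))} = q ` {1..n} \<and>
     (\<forall>i \<in> {1..n}. closed_segment (q i) (q (i mod n + 1)) edge_of (convex hull (q ` {1..n})))"

definition bounded_by_line :: "(real \<times> real) set \<Rightarrow> (real \<times> real) set \<Rightarrow> bool" where
  "bounded_by_line l H \<longleftrightarrow> (\<exists>u c. u \<noteq> 0 \<and> l = {z. u \<bullet> z = c} \<and> H = {z. u \<bullet> z > c})"

text \<open>
  Meaningful for relevant edges of a configuration of \<open>2k+3\<close> points in convex position, where
  exactly one of the two sides contains \<open>k+1\<close> of the points.
\<close>

definition big_half_plane :: "nat \<Rightarrow> (nat \<Rightarrow> real \<times> real) \<Rightarrow> nat set \<Rightarrow> (real \<times> real) set" where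
  "big_half_plane k q e = (THE H. bounded_by_line (affine hull (q ` e)) H \<and>
     card {i \<in> {1..2*k+3}. q i \<in> H} = k + 1)"

definition c_vec :: "nat \<Rightarrow> real \<times> real \<Rightarrow> real \<times> real \<Rightarrow> nat \<Rightarrow> real" where
  "c_vec d p p' m = (snd p - snd p') ^ m * (fst p - fst p') ^ (d - 1 - m)"

text \<open>
  The row of the edge \<open>e = {i, j}\<close>, \<open>i < j\<close>, of \<open>C_d(q)\<close>. Column \<open>(v, m)\<close> with \<open>m < d\<close> is the
  \<open>m\<close>-th column (counted from 0) of the block of vertex \<open>v\<close>. Rows live in the real vector space
  of finitely supported functions on \<open>nat \<times> nat\<close>, so that the ambient space is a single type for
  all \<open>d\<close> and \<open>n\<close>; only columns with \<open>v \<in> {1..n}\<close> and \<open>m < d\<close> are ever nonzero.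
\<close>

definition C_row :: "nat \<Rightarrow> (nat \<Rightarrow> real \<times> real) \<Rightarrow> nat set \<Rightarrow> (nat \<times> nat) \<Rightarrow>\<^sub>0 real" where
  "C_row d q e = (let i = Min e; j = Max e in
     \<Sum>m<d. Poly_Mapping.single (i, m) (c_vec d (q i) (q j) m)
          + Poly_Mapping.single (j, m) (- c_vec d (q i) (q j) m))"

lemma lookup_C_row:
  assumes "i < j"
  shows "Poly_Mapping.lookup (C_row d q {i, j}) (v, m) =
    (if m < d then
       if v = i then c_vec d (q i) (q j) m
       else if v = j then - c_vec d (q i) (q j) m
       else 0
     else 0)"
proof -
  have [simp]: "Min {i, j} = i" "Max {i, j} = j"
    using assms by (simp_all add: min_def max_def)
  have "Poly_Mapping.lookup (C_row d q {i, j}) (v, m) =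
      (\<Sum>m'<d. if m' = m then (if v = i then c_vec d (q i) (q j) m
         else if v = j then - c_vec d (q i) (q j) m else 0) else 0)"
    unfolding C_row_def Let_def lookup_sum
    by (rule sum.cong) (use assms in \<open>auto simp: lookup_add lookup_single when_def\<close>)
  also have "\<dots> = (if m < d then if v = i then c_vec d (q i) (q j) m
       else if v = j then - c_vec d (q i) (q j) m else 0 else 0)"
    by (subst sum.delta) simp_all
  finally show ?thesis .
qed

text \<open>
  Elements of a quotient by the subspace \<open>L\<close> are cosets \<open>x + L\<close>. The linear combination of the
  classes of the \<open>v e\<close> with coefficients \<open>c e\<close> is the class of the linear combination
  of the \<open>v e\<close>.
\<close>

definition coset :: "'v::real_vector set \<Rightarrow> 'v \<Rightarrow> 'v set" where
  "coset L x = (+) x ` L"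

definition quot_space :: "'v::real_vector set \<Rightarrow> 'v set \<Rightarrow> 'v set set" where
  "quot_space L W = coset L ` W"

definition quot_comb ::
    "'v::real_vector set \<Rightarrow> ('e \<Rightarrow> 'v) \<Rightarrow> ('e \<Rightarrow> real) \<Rightarrow> 'e set \<Rightarrow> 'v set" where
  "quot_comb L v c F = coset L (\<Sum>e\<in>F. c e *\<^sub>R v e)"

definition quot_independent ::
    "'v::real_vector set \<Rightarrow> ('e \<Rightarrow> 'v) \<Rightarrow> 'e set \<Rightarrow> bool" where
  "quot_independent L v F \<longleftrightarrow> (\<forall>c. quot_comb L v c F = coset L 0 \<longrightarrow> (\<forall>e\<in>F. c e = 0))"

text \<open>\<open>dim (W / L) = m\<close>: the quotient has a basis with \<open>m\<close> elements, the classes of the \<open>b i\<close>.\<close>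

definition quot_has_dim :: "'v::real_vector set \<Rightarrow> 'v set \<Rightarrow> nat \<Rightarrow> bool" where
  "quot_has_dim L W m \<longleftrightarrow> (\<exists>b. (\<forall>i<m. b i \<in> W) \<and> quot_independent L b {..<m} \<and>
     quot_space L W = {quot_comb L b c {..<m} | c. True})"

definition quot_cone ::
    "'v::real_vector set \<Rightarrow> ('e \<Rightarrow> 'v) \<Rightarrow> 'e set \<Rightarrow> 'v set set" where
  "quot_cone L v F = {quot_comb L v c F | c. \<forall>e\<in>F. 0 \<le> c e}"

definition complete_simplicial_fan ::
    "'v::real_vector set \<Rightarrow> 'v set \<Rightarrow> ('e \<Rightarrow> 'v) \<Rightarrow> 'e set set \<Rightarrow> bool" where
  "complete_simplicial_fan L W v \<Delta> \<longleftrightarrow>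
     (\<forall>F\<in>\<Delta>. quot_independent L v F) \<and>
     (\<forall>F\<in>\<Delta>. \<forall>G\<in>\<Delta>. quot_cone L v F \<inter> quot_cone L v G = quot_cone L v (F \<inter> G)) \<and>
     (\<Union>F\<in>\<Delta>. quot_cone L v F) = quot_space L W"

definition realizes_complete_fan ::
    "nat \<Rightarrow> nat \<Rightarrow> (nat set \<Rightarrow> 'v::real_vector) \<Rightarrow> bool" where
  "realizes_complete_fan k n v \<longleftrightarrow>
     (let W = span (v ` all_edges n); L = span (v ` short_edges k n) in
       quot_has_dim L W (k * (n - 2 * k - 1)) \<and>
       complete_simplicial_fan L W v (reduced_complex k n))"

end

theory Submission
  imports Defs
begin

text \<open>
  Write \<open>n = 2k + 3\<close> and lift the plane to homogeneous points \<open>p = (P, w)\<close> of \<open>\<real>\<^sup>2 \<times> \<real>\<close>: a point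
  \<open>z\<close> becomes \<open>(z, 1)\<close> and a direction \<open>z\<close> becomes \<open>(z, 0)\<close>. For a relevant edge \<open>e\<close> let \<open>h e\<close> be
  the linear form on this space that vanishes on the line of \<open>e\<close> and is positive on its big
  half-plane.

  The rows of the matrix for \<open>d = 2k\<close> are Gale dual to these forms. At a vertex, a
  self-stress of the complete graph is a linear dependence among \<open>d + 2\<close> points of the moment curve
  of degree \<open>d - 1\<close>; by Lagrange interpolation such dependences are given by one linear form
  (\<open>moment_dependence_iff\<close>).
  The forms at different vertices fit together only if they come from a common homogeneous point \<open>p\<close>
  (\<open>symmetric_stress_iff\<close>), and the stress on \<open>e\<close> is then a positive multiple of \<open>\<plusminus> h e p\<close>, with the
  same sign for all relevant edges. Hence a combination of the relevant rows lies in the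
  span of the short ones iff its coefficients are \<open>h e p / \<bar>den e\<bar>\<close> for some \<open>p\<close>
  (\<open>relevant_dependence_iff\<close>), so the nonnegative representations of a class modulo the short rows
  form a polyhedron \<open>{p. \<forall>e. c e + h e p \<ge> 0}\<close> in three-space.

  Combinatorially, \<open>k + 1\<close> relevant edges cross pairwise iff they are exactly the edges that have
  some vertex \<open>u\<close> in their big half-plane; this set is \<open>across u\<close>. So \<open>F\<close> is a face iff its
  complement meets every \<open>across u\<close>.

  The geometric core is \<open>direction_sees_across\<close>: along every nonzero direction, all forms of some
  \<open>across u\<close> strictly increase. If a point \<open>P0\<close> lies in all big half-planes, it follows
  (\<open>recession\<close>) that on the complement of a face the forms \<open>h e\<close> cannot all be nonnegative at a
  nonzero \<open>p\<close> with \<open>w \<le> 0\<close>. Therefore \<open>w\<close> has a minimiser on the above polyhedron, and a point whose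
  active constraints include the complement of a face is the unique minimiser. Conversely the
  minimiser is such a point: if no constraint in \<open>across u\<close> were active, moving by a small
  negative multiple of \<open>(q u, 1)\<close> would decrease \<open>w\<close>. So every class has exactly one
  nonnegative representation supported on a face, which is the fan property.

  Conversely, in a complete fan the class of minus the sum of all relevant rows lies in a cone, so
  some \<open>p\<close> makes all \<open>h e p\<close> positive, and \<open>direction_sees_across\<close> forces \<open>w > 0\<close>
  (\<open>positive_imp_affine\<close>): \<open>P / w\<close> lies in all big half-planes.

  Finally, by Helly's theorem the big half-planes of all relevant edges meet if those of any three
  do. Three edges whose big half-planes do not meet have pairwise disjoint endpoints and do not lie
  in one set \<open>across u\<close>, and this makes their complement an octahedral \<open>k\<close>-triangulation
  (\<open>octahedral_complement\<close>).
\<close>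

section \<open>Homogeneous points of the plane\<close>

definition cross2 :: "real \<times> real \<Rightarrow> real \<times> real \<Rightarrow> real" where
  "cross2 a b = fst a * snd b - snd a * fst b"

definition orient :: "real \<times> real \<Rightarrow> real \<times> real \<Rightarrow> real \<times> real \<Rightarrow> real" where
  "orient a b c = cross2 (b - a) (c - a)"

text \<open>
  The determinant of the homogeneous points \<open>(a, 1)\<close>, \<open>(b, 1)\<close> and \<open>p\<close>, in a form that shows its
  linearity in \<open>p\<close> and its dependence on \<open>a - b\<close>.
\<close>

definition hdet :: "real \<times> real \<Rightarrow> real \<times> real \<Rightarrow> (real \<times> real) \<times> real \<Rightarrow> real" where
  "hdet a b p = cross2 (a - b) (snd p *\<^sub>R b - fst p)"

lemma cross2_self [simp]: "cross2 a a = 0"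
  by (simp add: cross2_def)

lemma cross2_anticomm: "cross2 a b = - cross2 b a"
  by (simp add: cross2_def)

lemma cross2_linear_simps:
  "cross2 (a + b) c = cross2 a c + cross2 b c" "cross2 a (b + c) = cross2 a b + cross2 a c"
  "cross2 (a - b) c = cross2 a c - cross2 b c" "cross2 a (b - c) = cross2 a b - cross2 a c"
  "cross2 (r *\<^sub>R a) c = r * cross2 a c" "cross2 a (r *\<^sub>R c) = r * cross2 a c"
  "cross2 (- a) c = - cross2 a c" "cross2 a (- c) = - cross2 a c"
  by (simp_all add: cross2_def algebra_simps)

lemma cross2_eq_zero_imp:
  assumes "cross2 a b \<noteq> 0" "cross2 a z = 0" "cross2 b z = 0"
  shows "z = 0"
proof -
  have "cross2 a b * fst z = fst a * cross2 b z * - 1 + fst b * cross2 a z"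
    "cross2 a b * snd z = snd b * cross2 a z - snd a * cross2 b z"
    by (simp_all add: cross2_def algebra_simps)
  then have "fst z = 0" "snd z = 0" using assms by auto
  then show ?thesis by (simp add: prod_eq_iff)
qed

lemma cross2_zero_imp_parallel:
  assumes "cross2 x y = 0" "x \<noteq> 0"
  shows "\<exists>w. y = w *\<^sub>R x"
proof (cases "fst x = 0")
  case True
  then have "snd x \<noteq> 0" using assms by (auto simp: prod_eq_iff)
  then show ?thesis using True assms
    by (intro exI[of _ "snd y / snd x"]) (auto simp: prod_eq_iff cross2_def)
next
  case False
  then show ?thesis using assms
    by (intro exI[of _ "fst y / fst x"]) (auto simp: prod_eq_iff cross2_def field_simps)
qed

lemma orient_rotate: "orient b c a = orient a b c"
  and orient_swap: "orient b a c = - orient a b c"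
  by (simp_all add: orient_def cross2_def algebra_simps)

lemma orient_degenerate [simp]: "orient a b a = 0" "orient a b b = 0" "orient a a b = 0"
  by (simp_all add: orient_def cross2_def)

lemma hdet_affine: "hdet a b (c, 1) = orient a b c"
  by (simp add: hdet_def orient_def cross2_def algebra_simps)

lemma hdet_direction: "hdet a b (z, 0) = cross2 (b - a) z"
  by (simp add: hdet_def cross2_def algebra_simps)

lemma hdet_swap: "hdet b a p = - hdet a b p"
  by (simp add: hdet_def cross2_def algebra_simps)

lemma hdet_linear_simps:
  "hdet a b (p + p') = hdet a b p + hdet a b p'"
  "hdet a b (p - p') = hdet a b p - hdet a b p'"
  "hdet a b (r *\<^sub>R p) = r * hdet a b p"
  "hdet a b (- p) = - hdet a b p"
  "hdet a b 0 = 0"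
  by (simp_all add: hdet_def cross2_def algebra_simps)

lemma continuous_on_hdet: "continuous_on S (hdet a b)"
  unfolding hdet_def cross2_def by (intro continuous_intros)

section \<open>Self-stresses of points in general position\<close>

lemma sum_cancel_factor:
  fixes u :: "'i \<Rightarrow> real \<times> real" and R :: "'i \<Rightarrow> real"
  assumes "finite J" "a \<in> J" and np: "\<And>i j. i \<in> J \<Longrightarrow> j \<in> J \<Longrightarrow> i \<noteq> j \<Longrightarrow> cross2 (u i) (u j) \<noteq> 0"
  shows "(\<Sum>j\<in>J. cross2 (u j) (u a) * R j / (\<Prod>l\<in>J - {j}. cross2 (u j) (u l))) =
         (\<Sum>j\<in>J - {a}. R j / (\<Prod>l\<in>J - {a} - {j}. cross2 (u j) (u l)))"
proof -
  have "(\<Sum>j\<in>J. cross2 (u j) (u a) * R j / (\<Prod>l\<in>J - {j}. cross2 (u j) (u l))) =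
     (\<Sum>j\<in>J - {a}. cross2 (u j) (u a) * R j / (\<Prod>l\<in>J - {j}. cross2 (u j) (u l)))"
    using assms by (simp add: sum.remove)
  also have "\<dots> = (\<Sum>j\<in>J - {a}. R j / (\<Prod>l\<in>J - {a} - {j}. cross2 (u j) (u l)))"
  proof (rule sum.cong)
    fix j assume j: "j \<in> J - {a}"
    have "J - {j} = insert a (J - {a} - {j})" using j assms by auto
    then have "(\<Prod>l\<in>J - {j}. cross2 (u j) (u l)) =
        cross2 (u j) (u a) * (\<Prod>l\<in>J - {a} - {j}. cross2 (u j) (u l))"
      using assms by simp
    moreover have "cross2 (u j) (u a) \<noteq> 0" using j assms by auto
    ultimately show "cross2 (u j) (u a) * R j / (\<Prod>l\<in>J - {j}. cross2 (u j) (u l)) =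
        R j / (\<Prod>l\<in>J - {a} - {j}. cross2 (u j) (u l))"
      by simp
  qed simp
  finally show ?thesis .
qed

text \<open>
  In homogeneous form, the divided difference at \<open>card J\<close> points of a polynomial of degree
  \<open>card J - 2\<close>, here a product of linear forms. A form \<open>l\<close> is a
  combination of the forms that vanish at two of the points, \<open>u a\<close> and \<open>u b\<close>; each of these cancels
  a factor of the denominators and removes its point, which is the induction step.
\<close>

lemma homogeneous_lagrange:
  fixes u :: "'i \<Rightarrow> real \<times> real"
  assumes "finite J" "card J = length ls + 2"
    and "\<And>i j. i \<in> J \<Longrightarrow> j \<in> J \<Longrightarrow> i \<noteq> j \<Longrightarrow> cross2 (u i) (u j) \<noteq> 0"
  shows "(\<Sum>j\<in>J. (\<Prod>l\<leftarrow>ls. cross2 l (u j)) / (\<Prod>l\<in>J - {j}. cross2 (u j) (u l))) = 0"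
  using assms
proof (induction ls arbitrary: J)
  case Nil
  then have "card J = 2" by simp
  then obtain a b where J: "J = {a, b}" "a \<noteq> b" by (meson card_2_iff)
  then have "cross2 (u a) (u b) \<noteq> 0" using Nil by auto
  moreover have "{a, b} - {a} = {b}" "{a, b} - {b} = {a}" using J by auto
  ultimately show ?case using J cross2_anticomm[of "u a" "u b"] by (simp add: field_simps)
next
  case (Cons l ls)
  define R where "R j = (\<Prod>l\<leftarrow>ls. cross2 l (u j))" for j
  define D where "D j = (\<Prod>l\<in>J - {j}. cross2 (u j) (u l))" for j
  have "J \<noteq> {}" using Cons.prems by auto
  then obtain a where a: "a \<in> J" by auto
  have "card (J - {a}) \<noteq> 0" using a Cons.prems by simp
  then obtain b where b: "b \<in> J" "b \<noteq> a" by (metis Diff_iff all_not_in_conv card.empty singletonI)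
  define c where "c = cross2 (u a) (u b)"
  have c: "c \<noteq> 0" unfolding c_def using a b Cons.prems by auto
  define r s where "r = - cross2 l (u b) / c" and "s = - cross2 (u a) l / c"
  have l: "cross2 l (u j) = r * cross2 (u j) (u a) + s * cross2 (u j) (u b)" for j
  proof -
    have "c * cross2 l (u j) = - cross2 l (u b) * cross2 (u j) (u a) - cross2 (u a) l * cross2 (u j) (u b)"
      unfolding c_def by (simp add: cross2_def algebra_simps)
    then show ?thesis unfolding r_def s_def using c by (simp add: field_simps)
  qed
  have red: "(\<Sum>j\<in>J. cross2 (u j) (u x) * R j / D j) = 0" if "x \<in> J" for x
  proof -
    have "(\<Sum>j\<in>J - {x}. R j / (\<Prod>l\<in>J - {x} - {j}. cross2 (u j) (u l))) = 0"
      unfolding R_def by (rule Cons.IH) (use Cons.prems that in auto)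
    then show ?thesis
      unfolding D_def using sum_cancel_factor[OF Cons.prems(1) that, of u R] Cons.prems(3) by auto
  qed
  have "(\<Sum>j\<in>J. (\<Prod>l\<leftarrow>l # ls. cross2 l (u j)) / D j) =
     (\<Sum>j\<in>J. r * (cross2 (u j) (u a) * R j / D j) + s * (cross2 (u j) (u b) * R j / D j))"
    by (rule sum.cong) (simp_all add: l R_def algebra_simps add_divide_distrib)
  also have "\<dots> = 0"
    by (simp only: sum.distrib sum_distrib_left[symmetric] red[OF a] red[OF b(1)] mult_zero_right add_0_right)
  finally show ?case by (simp add: D_def)
qed

text \<open>
  Peeling off one factor of the product and absorbing it into the coefficients lowers the degree of
  the moments by one.
\<close>

lemma moments_vanish_imp_products_vanish:
  fixes u :: "'i \<Rightarrow> real \<times> real" and c :: "'i \<Rightarrow> real"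
  assumes "\<And>m. m \<le> length ls \<Longrightarrow> (\<Sum>j\<in>J. c j * (snd (u j) ^ m * fst (u j) ^ (length ls - m))) = 0"
  shows "(\<Sum>j\<in>J. c j * (\<Prod>l\<leftarrow>ls. cross2 l (u j))) = 0"
  using assms
proof (induction ls arbitrary: c)
  case Nil
  then show ?case by auto
next
  case (Cons l ls)
  have "(\<Sum>j\<in>J. (c j * cross2 l (u j)) * (\<Prod>l\<leftarrow>ls. cross2 l (u j))) = 0"
  proof (rule Cons.IH)
    fix m assume m: "m \<le> length ls"
    have "(\<Sum>j\<in>J. c j * cross2 l (u j) * (snd (u j) ^ m * fst (u j) ^ (length ls - m))) =
      (\<Sum>j\<in>J. fst l * (c j * (snd (u j) ^ Suc m * fst (u j) ^ (length (l # ls) - Suc m)))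
         - snd l * (c j * (snd (u j) ^ m * fst (u j) ^ (length (l # ls) - m))))"
      using m by (intro sum.cong) (simp_all add: cross2_def algebra_simps Suc_diff_le)
    also have "\<dots> = 0"
      using Cons.prems[of "Suc m"] Cons.prems[of m] m
      by (simp add: sum_subtractf flip: sum_distrib_left)
    finally show "(\<Sum>j\<in>J. c j * cross2 l (u j) * (snd (u j) ^ m * fst (u j) ^ (length ls - m))) = 0" .
  qed
  then show ?case by (simp add: mult.assoc)
qed

text \<open>
  The points \<open>u j\<close> are pairwise independent, so any \<open>d\<close> of the \<open>d + 2\<close> moment vectors of degree
  \<open>d - 1\<close> are linearly independent. The space of dependences is thus two-dimensional, as is the
  space of linear forms \<open>l\<close>, and by the Lagrange identity every \<open>l\<close> yields a dependence. Concretely,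
  a dependence is determined by two of its coefficients, and \<open>l\<close> can be chosen to match these.
\<close>

lemma moment_dependence_iff:
  fixes u :: "'i \<Rightarrow> real \<times> real" and c :: "'i \<Rightarrow> real"
  assumes J: "finite J" "card J = d + 2"
    and np: "\<And>i j. i \<in> J \<Longrightarrow> j \<in> J \<Longrightarrow> i \<noteq> j \<Longrightarrow> cross2 (u i) (u j) \<noteq> 0"
  shows "(\<forall>m<d. (\<Sum>j\<in>J. c j * (snd (u j) ^ m * fst (u j) ^ (d - 1 - m))) = 0) \<longleftrightarrow>
    (\<exists>l. \<forall>j\<in>J. c j = cross2 l (u j) / (\<Prod>i\<in>J - {j}. cross2 (u j) (u i)))"
proof -
  define D where "D j = (\<Prod>i\<in>J - {j}. cross2 (u j) (u i))" for j
  have D0: "D j \<noteq> 0" if "j \<in> J" for j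
    unfolding D_def using that np J by (subst prod_zero_iff) auto
  have lag: "(\<Sum>j\<in>J. cross2 l (u j) / D j * (snd (u j) ^ m * fst (u j) ^ (d - 1 - m))) = 0"
    if m: "m < d" for l m
  proof -
    have prl: "prod_list (map f (replicate n x)) = f x ^ n" for f :: "real \<times> real \<Rightarrow> real" and n x
      by (induction n) auto
    \<comment> \<open>The monomial of degree \<open>d - 1\<close> as a product of coordinate forms, times \<open>l\<close>.\<close>
    define ls where "ls = l # replicate m (1, 0) @ replicate (d - 1 - m) (0, -1 :: real)"
    have "(\<Sum>j\<in>J. (\<Prod>l\<leftarrow>ls. cross2 l (u j)) / (\<Prod>l\<in>J - {j}. cross2 (u j) (u l))) = 0"
      by (rule homogeneous_lagrange) (use J m np in \<open>auto simp: ls_def\<close>)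
    moreover have "(\<Prod>l\<leftarrow>ls. cross2 l y) = cross2 l y * (snd y ^ m * fst y ^ (d - 1 - m))" for y
      unfolding ls_def by (simp add: prl del: map_replicate) (simp add: cross2_def)
    ultimately show ?thesis by (simp add: D_def mult_ac)
  qed
  show ?thesis
  proof
    assume "\<exists>l. \<forall>j\<in>J. c j = cross2 l (u j) / (\<Prod>i\<in>J - {j}. cross2 (u j) (u i))"
    then obtain l where "\<forall>j\<in>J. c j = cross2 l (u j) / D j" by (auto simp: D_def)
    then show "\<forall>m<d. (\<Sum>j\<in>J. c j * (snd (u j) ^ m * fst (u j) ^ (d - 1 - m))) = 0"
      using lag[of _ l] by simp
  next
    assume dep: "\<forall>m<d. (\<Sum>j\<in>J. c j * (snd (u j) ^ m * fst (u j) ^ (d - 1 - m))) = 0"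
    have "J \<noteq> {}" using J by auto
    then obtain a where a: "a \<in> J" by auto
    have "card (J - {a}) \<noteq> 0" using a J by simp
    then obtain b where b: "b \<in> J" "b \<noteq> a" by (metis Diff_iff all_not_in_conv card.empty singletonI)
    define e where "e = cross2 (u a) (u b)"
    have e: "e \<noteq> 0" unfolding e_def using a b np by auto
    \<comment> \<open>The form that reproduces the coefficients at \<open>a\<close> and \<open>b\<close>.\<close>
    define l where "l = (c b * D b / e) *\<^sub>R u a - (c a * D a / e) *\<^sub>R u b"
    have la: "cross2 l (u a) = c a * D a"
      using e cross2_anticomm[of "u b" "u a"]
      by (simp add: l_def cross2_linear_simps flip: e_def)
    have lb: "cross2 l (u b) = c b * D b"
      using e by (simp add: l_def cross2_linear_simps flip: e_def)
    define c' where "c' j = c j - cross2 l (u j) / D j" for j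
    have c'ab: "c' a = 0" "c' b = 0" using la lb D0 a b by (auto simp: c'_def)
    have c'0: "c' j = 0" if j: "j \<in> J" for j
    proof (cases "j = a \<or> j = b")
      case False
      have fin: "finite (J - {a, b, j})" using J by simp
      obtain xs where xs: "set xs = J - {a, b, j}" "distinct xs"
        using finite_distinct_list[OF fin] by blast
      have "card (J - {a, b, j}) = d - 1"
        using J a b j False by (subst card_Diff_subset) auto
      then have len: "length xs = d - 1" using xs distinct_card by fastforce
      have "0 < d"
      proof -
        have "card {a, b, j} \<le> card J" using a b j J by (intro card_mono) auto
        then show ?thesis using J False b by auto
      qed
      \<comment> \<open>This product of \<open>d - 1\<close> forms vanishes at all points except \<open>a\<close>, \<open>b\<close> and \<open>j\<close>,
        and the remaining coefficients at \<open>a\<close> and \<open>b\<close> are zero.\<close>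
      have "(\<Sum>i\<in>J. c' i * (\<Prod>l\<leftarrow>map u xs. cross2 l (u i))) = 0"
      proof (rule moments_vanish_imp_products_vanish)
        fix m assume "m \<le> length (map u xs)"
        then have m: "m < d" using len \<open>0 < d\<close> by simp
        have "(\<Sum>i\<in>J. c' i * (snd (u i) ^ m * fst (u i) ^ (d - 1 - m))) = 0"
          using dep m lag[OF m, of l] by (simp add: c'_def left_diff_distrib sum_subtractf)
        then show "(\<Sum>i\<in>J. c' i * (snd (u i) ^ m * fst (u i) ^ (length (map u xs) - m))) = 0"
          using len by simp
      qed
      moreover have "(\<Sum>i\<in>J. c' i * (\<Prod>l\<leftarrow>map u xs. cross2 l (u i))) =
          (\<Sum>i\<in>{j}. c' i * (\<Prod>l\<leftarrow>map u xs. cross2 l (u i)))"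
      proof (rule sum.mono_neutral_right)
        show "\<forall>i\<in>J - {j}. c' i * (\<Prod>l\<leftarrow>map u xs. cross2 l (u i)) = 0"
        proof
          fix i assume i: "i \<in> J - {j}"
          show "c' i * (\<Prod>l\<leftarrow>map u xs. cross2 l (u i)) = 0"
          proof (cases "i = a \<or> i = b")
            case False
            then have "i \<in> set xs" using i xs by auto
            then have "0 \<in> set (map (\<lambda>l. cross2 l (u i)) (map u xs))"
              by (force simp: image_iff)
            then show ?thesis by (simp add: prod_list_zero_iff)
          qed (use c'ab in auto)
        qed
      qed (use J j in auto)
      moreover have "(\<Prod>l\<leftarrow>map u xs. cross2 l (u j)) \<noteq> 0"
        using xs np j by (auto simp: prod_list_zero_iff)
      ultimately show ?thesis by simp
    qed (use c'ab in auto)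
    have "\<forall>j\<in>J. c j = cross2 l (u j) / D j" using c'0 by (simp add: c'_def)
    then show "\<exists>l. \<forall>j\<in>J. c j = cross2 l (u j) / (\<Prod>i\<in>J - {j}. cross2 (u j) (u i))"
      unfolding D_def by (rule exI[of _ l])
  qed
qed

text \<open>
  A parallel redrawing of the complete graph is a dilation or translation: after subtracting the one
  that agrees with \<open>g\<close> at \<open>a\<close> and \<open>b\<close>, the value at any further vertex is parallel to two
  independent directions.
\<close>

lemma parallel_redrawing_trivial:
  fixes q g :: "'i \<Rightarrow> real \<times> real"
  assumes a: "a \<in> I" and b: "b \<in> I" and ab: "a \<noteq> b" and qab: "q a \<noteq> q b"
    and gen: "\<And>i. i \<in> I \<Longrightarrow> i \<noteq> a \<Longrightarrow> i \<noteq> b \<Longrightarrow> orient (q a) (q b) (q i) \<noteq> 0"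
    and par: "\<And>i j. i \<in> I \<Longrightarrow> j \<in> I \<Longrightarrow> i \<noteq> j \<Longrightarrow> cross2 (q i - q j) (g i - g j) = 0"
  shows "\<exists>P w. \<forall>i\<in>I. g i = w *\<^sub>R q i - P"
proof -
  obtain w where w: "g b - g a = w *\<^sub>R (q b - q a)"
    using cross2_zero_imp_parallel[of "q b - q a" "g b - g a"] par[of b a] a b ab qab by auto
  define P where "P = w *\<^sub>R q a - g a"
  have ga: "g a = w *\<^sub>R q a - P" by (simp add: P_def)
  have gb: "g b = w *\<^sub>R q b - P"
  proof -
    have "g b = g a + w *\<^sub>R (q b - q a)" using w by (simp add: algebra_simps)
    then show ?thesis by (simp add: P_def algebra_simps)
  qed
  have "g i = w *\<^sub>R q i - P" if i: "i \<in> I" for i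
  proof (cases "i = a \<or> i = b")
    case False
    define z where "z = g i - (w *\<^sub>R q i - P)"
    have "cross2 (q i - q x) z = 0" if "x \<in> I" "x \<noteq> i" "g x = w *\<^sub>R q x - P" for x
    proof -
      have "g i - g x = z + w *\<^sub>R (q i - q x)" using that by (simp add: z_def algebra_simps)
      then show ?thesis using par[OF i that(1)] that(2)
        by (simp add: cross2_linear_simps(2,6))
    qed
    then have "cross2 (q i - q a) z = 0" "cross2 (q i - q b) z = 0"
      using a b ga gb False by auto
    moreover have "cross2 (q i - q a) (q i - q b) = orient (q a) (q b) (q i)"
      by (simp add: orient_def cross2_def algebra_simps)
    ultimately have "z = 0" using gen[OF i] False cross2_eq_zero_imp by metis
    then show ?thesis by (simp add: z_def)
  qed (use ga gb in auto)
  then show ?thesis by blast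
qed

text \<open>
  The number of factors is \<open>2 * k + 1\<close>. Its parity is what makes the stress of an edge
  \<open>{i, j}\<close> independent of the order of \<open>i\<close> and \<open>j\<close>.
\<close>

lemma prod_orient_swap:
  fixes q :: "'i \<Rightarrow> real \<times> real"
  assumes "finite I" "card I = 2 * k + 3" "i \<in> I" "j \<in> I" "i \<noteq> j"
  shows "(\<Prod>l\<in>I - {j} - {i}. orient (q j) (q i) (q l)) = - (\<Prod>l\<in>I - {i} - {j}. orient (q i) (q j) (q l))"
proof -
  have "(\<Prod>l\<in>I - {j} - {i}. orient (q j) (q i) (q l)) = (\<Prod>l\<in>I - {i} - {j}. - orient (q i) (q j) (q l))"
    by (rule prod.cong) (auto simp: orient_swap[of "q j"])
  moreover have "card (I - {i} - {j}) = 2 * k + 1" using assms by auto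
  ultimately show ?thesis by (simp add: prod_uminus)
qed

text \<open>
  The dependences at the single vertices are given by linear forms \<open>l i\<close>. Symmetry of \<open>\<omega>\<close> says that
  \<open>l i\<close> and \<open>l j\<close> agree on \<open>q i - q j\<close>, so that rotating the vectors \<open>l i\<close> by a right angle gives a
  parallel redrawing of \<open>q\<close>; its two parameters are the coordinates of \<open>p\<close>.
\<close>

lemma symmetric_stress_iff:
  fixes q :: "'i \<Rightarrow> real \<times> real" and \<omega> :: "'i \<Rightarrow> 'i \<Rightarrow> real"
  assumes I: "finite I" "card I = 2 * k + 3"
    and gen: "\<And>i j l. i \<in> I \<Longrightarrow> j \<in> I \<Longrightarrow> l \<in> I \<Longrightarrow> i \<noteq> j \<Longrightarrow> j \<noteq> l \<Longrightarrow> i \<noteq> l \<Longrightarrow>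
       orient (q i) (q j) (q l) \<noteq> 0"
    and sym: "\<And>i j. \<omega> i j = \<omega> j i"
  shows "(\<forall>i\<in>I. \<forall>m<2*k. (\<Sum>j\<in>I - {i}. \<omega> i j * c_vec (2 * k) (q i) (q j) m) = 0) \<longleftrightarrow>
    (\<exists>p. \<forall>i\<in>I. \<forall>j\<in>I - {i}.
       \<omega> i j = hdet (q i) (q j) p / (\<Prod>l\<in>I - {i} - {j}. orient (q i) (q j) (q l)))"
proof -
  define B where "B i j = (\<Prod>l\<in>I - {i} - {j}. orient (q i) (q j) (q l))" for i j
  have B0: "B i j \<noteq> 0" if "i \<in> I" "j \<in> I" "i \<noteq> j" for i j
    unfolding B_def using that gen I by (subst prod_zero_iff) auto
  have Bsw: "B j i = - B i j" if "i \<in> I" "j \<in> I" "i \<noteq> j" for i j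
    unfolding B_def by (rule prod_orient_swap[OF I that])
  have vertex: "(\<forall>m<2*k. (\<Sum>j\<in>I - {i}. \<omega> i j * c_vec (2 * k) (q i) (q j) m) = 0) \<longleftrightarrow>
     (\<exists>l. \<forall>j\<in>I - {i}. \<omega> i j = cross2 l (q i - q j) / B i j)" if i: "i \<in> I" for i
  proof -
    have *: "cross2 (q i - q j) (q i - q l) = orient (q i) (q j) (q l)" for j l
      by (simp add: orient_def cross2_def algebra_simps)
    have cv: "c_vec (2 * k) (q i) (q j) m = snd (q i - q j) ^ m * fst (q i - q j) ^ (2 * k - 1 - m)" for j m
      by (simp add: c_vec_def)
    have "(\<forall>m<2*k. (\<Sum>j\<in>I - {i}. \<omega> i j * (snd (q i - q j) ^ m * fst (q i - q j) ^ (2 * k - 1 - m))) = 0) \<longleftrightarrow>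
      (\<exists>l. \<forall>j\<in>I - {i}. \<omega> i j = cross2 l (q i - q j) /
        (\<Prod>x\<in>I - {i} - {j}. cross2 (q i - q j) (q i - q x)))"
    proof (rule moment_dependence_iff)
      show "card (I - {i}) = 2 * k + 2" using i I by simp
      show "cross2 (q i - q j) (q i - q l) \<noteq> 0" if "j \<in> I - {i}" "l \<in> I - {i}" "j \<noteq> l" for j l
        unfolding * using that gen i by auto
    qed (use I in simp)
    then show ?thesis unfolding B_def cv * .
  qed
  show ?thesis
  proof
    assume "\<forall>i\<in>I. \<forall>m<2*k. (\<Sum>j\<in>I - {i}. \<omega> i j * c_vec (2 * k) (q i) (q j) m) = 0"
    then have "\<forall>i\<in>I. \<exists>l. \<forall>j\<in>I - {i}. \<omega> i j = cross2 l (q i - q j) / B i j"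
      using vertex by blast
    then obtain l where l: "\<And>i j. i \<in> I \<Longrightarrow> j \<in> I - {i} \<Longrightarrow> \<omega> i j = cross2 (l i) (q i - q j) / B i j"
      by metis
    have par: "cross2 (q i - q j) (- l i - - l j) = 0" if "i \<in> I" "j \<in> I" "i \<noteq> j" for i j
    proof -
      have "cross2 (l i) (q i - q j) / B i j = cross2 (l j) (q j - q i) / - B i j"
        using l[of i j] l[of j i] that sym[of i j] Bsw[OF that] by auto
      then have "cross2 (l i) (q i - q j) = - cross2 (l j) (q j - q i)"
        using B0[OF that] by (simp add: field_simps)
      then show ?thesis by (simp add: cross2_def algebra_simps)
    qed
    obtain T where "T \<subseteq> I" "card T = 3" using obtain_subset_with_card_n[of 3 I] I by auto
    then obtain a b c where abc: "a \<in> I" "b \<in> I" "c \<in> I" "a \<noteq> b" "b \<noteq> c" "a \<noteq> c"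
      by (auto simp: card_3_iff)
    then have "q a \<noteq> q b" using gen[of a b c] by auto
    then obtain P w where g: "\<forall>i\<in>I. - l i = w *\<^sub>R q i - P"
      using parallel_redrawing_trivial[of a I b q "\<lambda>i. - l i"] abc gen[of a b] par by auto
    have "\<omega> i j = hdet (q i) (q j) (P, w) / B i j" if "i \<in> I" "j \<in> I - {i}" for i j
    proof -
      have "cross2 (l i) (q i - q j) = cross2 (q i - q j) (- l i)"
        by (simp add: cross2_def algebra_simps)
      also have "\<dots> = hdet (q i) (q j) (P, w)"
        using g that by (simp add: hdet_def cross2_def algebra_simps)
      finally show ?thesis using l[OF that] by simp
    qed
    then show "\<exists>p. \<forall>i\<in>I. \<forall>j\<in>I - {i}.
       \<omega> i j = hdet (q i) (q j) p / (\<Prod>l\<in>I - {i} - {j}. orient (q i) (q j) (q l))"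
      unfolding B_def by blast
  next
    assume "\<exists>p. \<forall>i\<in>I. \<forall>j\<in>I - {i}.
       \<omega> i j = hdet (q i) (q j) p / (\<Prod>l\<in>I - {i} - {j}. orient (q i) (q j) (q l))"
    then obtain p where p: "\<forall>i\<in>I. \<forall>j\<in>I - {i}. \<omega> i j = hdet (q i) (q j) p / B i j"
      unfolding B_def by blast
    have "hdet (q i) (q j) p = cross2 (fst p - snd p *\<^sub>R q i) (q i - q j)" for i j
      by (simp add: hdet_def cross2_def algebra_simps)
    then have "\<exists>l. \<forall>j\<in>I - {i}. \<omega> i j = cross2 l (q i - q j) / B i j" if "i \<in> I" for i
      using p that by (intro exI[of _ "fst p - snd p *\<^sub>R q i"]) auto
    then show "\<forall>i\<in>I. \<forall>m<2*k. (\<Sum>j\<in>I - {i}. \<omega> i j * c_vec (2 * k) (q i) (q j) m) = 0"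
      using vertex by blast
  qed
qed

section \<open>Orientation of a convex polygon\<close>

lemma orient_affine: "orient a b ((1 - t) *\<^sub>R x + t *\<^sub>R y) = (1 - t) * orient a b x + t * orient a b y"
  by (simp add: orient_def cross2_def algebra_simps)

lemma extreme_point_off_segment:
  assumes "x extreme_point_of H" "a \<in> H" "b \<in> H" "x \<noteq> a" "x \<noteq> b"
  shows "x \<notin> closed_segment a b"
  using assms by (auto simp: extreme_point_of_def open_segment_def)

text \<open>
  One of three collinear points lies between the other two. This excludes collinear triples of
  extreme points, and below it locates the point in which a line through two extreme points is hit.
\<close>

lemma collinear_cases:
  assumes "orient a b c = 0" "a \<noteq> b"
  shows "c \<in> closed_segment a b \<or> a \<in> closed_segment c b \<or> b \<in> closed_segment a c"
proof -
  obtain w where w: "c - a = w *\<^sub>R (b - a)"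
    using cross2_zero_imp_parallel[of "b - a" "c - a"] assms by (auto simp: orient_def)
  then have c: "c = (1 - w) *\<^sub>R a + w *\<^sub>R b" by (simp add: algebra_simps)
  consider "w < 0" | "0 \<le> w" "w \<le> 1" | "1 < w" by linarith
  then show ?thesis
  proof cases
    case 1
    define u where "u = - w / (1 - w)"
    have "a = (1 - u) *\<^sub>R c + u *\<^sub>R b"
    proof -
      have "(1 - u) * (1 - w) = 1" "(1 - u) * w + u = 0" using 1 by (simp_all add: u_def field_simps)
      then show ?thesis
        by (simp add: c scaleR_add_right add.assoc flip: scaleR_add_left)
    qed
    moreover have "0 \<le> u" "u \<le> 1" using 1 by (auto simp: u_def field_simps)
    ultimately show ?thesis unfolding in_segment by blast
  next
    case 2
    then show ?thesis using c unfolding in_segment by blast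
  next
    case 3
    define u where "u = 1 / w"
    have "b = (1 - u) *\<^sub>R a + u *\<^sub>R c"
    proof -
      have "u * w = 1" "(1 - u) + u * (1 - w) = 0" using 3 by (simp_all add: u_def field_simps)
      then show ?thesis
        by (simp add: c scaleR_add_right flip: add.assoc scaleR_add_left)
    qed
    moreover have "0 \<le> u" "u \<le> 1" using 3 by (auto simp: u_def field_simps)
    ultimately show ?thesis unfolding in_segment by blast
  qed
qed

lemma extreme_points_not_collinear:
  assumes "a extreme_point_of H" "b extreme_point_of H" "c extreme_point_of H"
    and "a \<noteq> b" "b \<noteq> c" "a \<noteq> c"
  shows "orient a b c \<noteq> 0"
proof
  assume "orient a b c = 0"
  moreover have "a \<in> H" "b \<in> H" "c \<in> H" using assms by (auto simp: extreme_point_of_def)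
  ultimately show False
    using collinear_cases[of a b c] assms extreme_point_off_segment by metis
qed

text \<open>
  If \<open>x\<close> and \<open>y\<close> were strictly separated by the line of the edge, the segment between them would
  meet the line. The meeting point lies in the edge, since \<open>a\<close> and \<open>b\<close> are extreme, and then
  the face property puts \<open>x\<close> itself on the line.
\<close>

lemma same_side_of_edge:
  assumes "convex H" and face: "closed_segment a b face_of H"
    and a: "a extreme_point_of H" and b: "b extreme_point_of H" and "a \<noteq> b"
    and x: "x \<in> H" and y: "y \<in> H" and ox: "orient a b x > 0"
  shows "orient a b y \<ge> 0"
proof (rule ccontr)
  assume "\<not> orient a b y \<ge> 0"
  then have oy: "orient a b y < 0" by simp
  define t where "t = orient a b x / (orient a b x - orient a b y)"
  define m where "m = (1 - t) *\<^sub>R x + t *\<^sub>R y"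
  have t: "0 < t" "t < 1" using ox oy by (auto simp: t_def field_simps)
  have "orient a b m = 0"
    unfolding m_def orient_affine t_def using ox oy by (simp add: field_simps)
  then have "m \<in> closed_segment a b \<or> a \<in> closed_segment m b \<or> b \<in> closed_segment a m"
    using collinear_cases \<open>a \<noteq> b\<close> by blast
  moreover have "m \<in> H" using \<open>convex H\<close> x y t by (auto simp: m_def convex_alt)
  moreover have "a \<in> H" "b \<in> H" using a b by (auto simp: extreme_point_of_def)
  moreover have "a \<in> closed_segment a b" "b \<in> closed_segment a b" by simp_all
  ultimately have m: "m \<in> closed_segment a b"
    using extreme_point_off_segment[OF a] extreme_point_off_segment[OF b] \<open>a \<noteq> b\<close> by metis
  have "x \<noteq> y" using ox oy by auto
  then have "m \<in> open_segment x y" using t by (auto simp: m_def in_segment)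
  then have "x \<in> closed_segment a b" using face m x y by (auto simp: face_of_def)
  then obtain u where "x = (1 - u) *\<^sub>R a + u *\<^sub>R b" by (auto simp: in_segment)
  then have "orient a b x = 0" by (simp only: orient_affine) simp
  then show False using ox by simp
qed

text \<open>
  Each edge of the polygon has all other vertices strictly on one side. Consecutive edges share a
  triple of vertices, so the side is the same for all of them. For general triples, the vectors
  from \<open>q i\<close> to the later vertices turn in one direction step by step and lie in an open half-plane,
  where turning in that direction is transitive.
\<close>

lemma convex_position_oriented:
  assumes cp: "convex_position n q" and n: "n \<ge> 3"
  obtains s :: real where "s * s = 1"
    and "\<And>i j l. 1 \<le> i \<Longrightarrow> i < j \<Longrightarrow> j < l \<Longrightarrow> l \<le> n \<Longrightarrow> s * orient (q i) (q j) (q l) > 0"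
proof -
  define H where "H = convex hull (q ` {1..n})"
  have extr: "{x. x extreme_point_of H} = q ` {1..n}" and injq: "inj_on q {1..n}"
    and edge: "\<And>i. i \<in> {1..n} \<Longrightarrow> closed_segment (q i) (q (i mod n + 1)) edge_of H"
    using cp unfolding convex_position_def H_def by blast+
  have ext: "q i extreme_point_of H" if "1 \<le> i" "i \<le> n" for i
    using extr that by (metis atLeastAtMost_iff image_eqI mem_Collect_eq)
  have inH: "q i \<in> H" if "1 \<le> i" "i \<le> n" for i
    using ext[OF that] by (simp add: extreme_point_of_def)
  have inj: "q i \<noteq> q j" if "1 \<le> i" "i \<le> n" "1 \<le> j" "j \<le> n" "i \<noteq> j" for i j
    using inj_onD[OF injq, of i j] that by auto
  have face: "closed_segment (q i) (q (Suc i)) face_of H" if "1 \<le> i" "i < n" for i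
    using edge[of i] that by (simp add: edge_of_def)
  have nz: "orient (q i) (q j) (q l) \<noteq> 0"
    if "1 \<le> i" "i \<le> n" "1 \<le> j" "j \<le> n" "1 \<le> l" "l \<le> n" "i \<noteq> j" "j \<noteq> l" "i \<noteq> l" for i j l
    by (rule extreme_points_not_collinear[of _ H]) (use that ext inj in auto)
  define s where "s = sgn (orient (q 1) (q 2) (q 3))"
  have "orient (q 1) (q 2) (q 3) \<noteq> 0" using nz n by simp
  then have s: "s * s = 1" "s = 1 \<or> s = -1" "s * orient (q 1) (q 2) (q 3) > 0"
    by (auto simp: s_def sgn_real_def)
  have spread: "s * orient (q i) (q (Suc i)) (q m) > 0"
    if "1 \<le> i" "i < n" "1 \<le> l" "l \<le> n" "l \<noteq> i" "l \<noteq> Suc i" "s * orient (q i) (q (Suc i)) (q l) > 0"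
      "1 \<le> m" "m \<le> n" "m \<noteq> i" "m \<noteq> Suc i" for i l m
  proof -
    have conv: "convex H" by (simp add: H_def)
    have ne: "q i \<noteq> q (Suc i)" using inj that by auto
    have A: "orient (q i) (q (Suc i)) y \<ge> 0" if "x \<in> H" "y \<in> H" "orient (q i) (q (Suc i)) x > 0" for x y
      by (rule same_side_of_edge[OF conv face ext ext ne that(1,2,3)])
         (use \<open>1 \<le> i\<close> \<open>i < n\<close> in auto)
    have "orient (q i) (q (Suc i)) (q m) \<noteq> 0" by (rule nz) (use that in auto)
    then show ?thesis
      using A[of "q l" "q m"] A[of "q m" "q l"] s(2) that inH[of l] inH[of m] by force
  qed
  have consec: "\<forall>l. 1 \<le> l \<and> l \<le> n \<and> l \<noteq> i \<and> l \<noteq> Suc i \<longrightarrow> s * orient (q i) (q (Suc i)) (q l) > 0"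
    if "1 \<le> i" "i < n" for i
    using that
  proof (induction i rule: nat_induct_at_least)
    case base
    have "s * orient (q 1) (q (Suc 1)) (q 3) > 0" using s(3) by (simp add: numeral_2_eq_2)
    then show ?case using spread[of 1 3] n by auto
  next
    case (Suc i)
    then have "s * orient (q i) (q (Suc i)) (q (Suc (Suc i))) > 0" by auto
    then have "s * orient (q (Suc i)) (q (Suc (Suc i))) (q i) > 0"
      by (simp add: orient_rotate)
    then show ?case using spread[of "Suc i" i] Suc by auto
  qed
  have "s * orient (q i) (q j) (q l) > 0" if "1 \<le> i" "i < j" "j < l" "l \<le> n" for i j l
  proof -
    from \<open>j < l\<close> have "Suc j \<le> l" by simp
    then show ?thesis using \<open>l \<le> n\<close>
    proof (induction l rule: dec_induct)
      case base
      then have "s * orient (q j) (q (Suc j)) (q i) > 0" using consec[of j] that by auto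
      then show ?case by (simp add: orient_rotate)
    next
      case (step l)
      show ?case
      proof (cases "j = Suc i")
        case True
        then show ?thesis using consec[of i] that step by auto
      next
        case False
        define D where "D x y = s * cross2 (q x - q i) (q y - q i)" for x y
        have D: "D x y = s * orient (q i) (q x) (q y)" for x y by (simp add: D_def orient_def)
        have pos: "D (Suc i) l > 0" "D (Suc i) (Suc l) > 0" "D (Suc i) j > 0"
          unfolding D using consec[of i] that step False by auto
        have "D j l > 0" unfolding D using step by simp
        moreover have "D l (Suc l) > 0"
        proof -
          have "1 \<le> l" "l < n" "1 \<le> i \<and> i \<le> n \<and> i \<noteq> l \<and> i \<noteq> Suc l" using that step by auto
          then have "s * orient (q l) (q (Suc l)) (q i) > 0" using consec by blast
          then show ?thesis by (simp only: D orient_rotate[of "q l" "q (Suc l)" "q i"])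
        qed
        \<comment> \<open>The Pluecker relation of four vectors in the plane.\<close>
        moreover have "D (Suc i) l * D j (Suc l) = D (Suc i) j * D l (Suc l) + D (Suc i) (Suc l) * D j l"
          unfolding D_def cross2_def by algebra
        ultimately have "D (Suc i) l * D j (Suc l) > 0"
          using pos by (metis add_pos_pos mult_pos_pos)
        then have "D j (Suc l) > 0" using pos(1) zero_less_mult_pos by blast
        then show ?thesis unfolding D .
      qed
    qed
  qed
  then show thesis using that s(1) by blast
qed

section \<open>The star polygon of relevant edges\<close>

text \<open>
  The sign \<open>s\<close> records whether the polygon is traversed counterclockwise or clockwise.
\<close>

locale star_polygon =
  fixes k n :: nat and q :: "nat \<Rightarrow> real \<times> real" and s :: real
  assumes n_def: "n = 2 * k + 3" and k_pos: "k \<ge> 1" and s_square: "s * s = 1"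
    and oriented: "1 \<le> i \<Longrightarrow> i < j \<Longrightarrow> j < l \<Longrightarrow> l \<le> n \<Longrightarrow> s * orient (q i) (q j) (q l) > 0"
begin

text \<open>
  Vertices are addressed by residues modulo \<open>n\<close>: \<open>vert\<close> is periodic, so that cyclic intervals can be
  written as ordinary intervals of natural numbers. The relevant edges \<open>star a\<close> form a single closed
  polygon, since \<open>star a\<close> and \<open>star (a + k + 1)\<close> share an endpoint and \<open>k + 1\<close> is coprime to \<open>n\<close>.
\<close>

definition vert :: "nat \<Rightarrow> nat" where "vert t = Suc (t mod n)"

abbreviation Q :: "nat \<Rightarrow> real \<times> real" where "Q t \<equiv> q (vert t)"

definition star :: "nat \<Rightarrow> nat set" where "star a = {vert a, vert (a + k + 1)}"

text \<open>
  The relevant edges that have the vertex \<open>u\<close> in their open big half-plane; see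
  \<open>h_across_pos\<close> and \<open>h_not_across\<close>.
\<close>

definition across :: "nat \<Rightarrow> nat set set" where "across u = star ` {u + 1..u + k + 1}"

abbreviation rel :: "nat set set" where "rel \<equiv> relevant_edges k n"

text \<open>
  On a relevant edge this form is positive on the side with \<open>k + 1\<close> vertices: these follow the
  larger endpoint cyclically if the endpoints differ by \<open>k + 1\<close>, and lie between the endpoints if
  they differ by \<open>k + 2\<close>. Directing \<open>star a\<close> from \<open>vert a\<close> to \<open>vert (a + k + 1)\<close> absorbs the
  case distinction (\<open>h_star\<close>).
\<close>

definition h :: "nat set \<Rightarrow> (real \<times> real) \<times> real \<Rightarrow> real" where
  "h e p = s * (if Max e - Min e = k + 1 then 1 else -1) * hdet (q (Min e)) (q (Max e)) p"

lemma nk: "2 * k + 3 \<le> n" "n \<le> 2 * k + 3"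
  by (simp_all add: n_def)

lemma n_ge: "n \<ge> 5" using nk k_pos by simp

lemma vert_periodic [simp]: "vert (t + n) = vert t" "vert (t + n * m) = vert t" "vert (t mod n) = vert t"
  by (simp_all add: vert_def)

lemma vert_range: "1 \<le> vert t" "vert t \<le> n" "vert t \<in> {1..n}"
  using mod_less_divisor[of n t] n_ge by (simp_all add: vert_def Suc_le_eq)

lemma vert_eq_iff: "vert x = vert y \<longleftrightarrow> x mod n = y mod n" by (simp add: vert_def)

lemma vert_inj_window: "x < y \<Longrightarrow> y < x + n \<Longrightarrow> vert x \<noteq> vert y"
proof
  assume "x < y" "y < x + n" "vert x = vert y"
  then have "n dvd y - x" by (metis less_imp_le mod_eq_dvd_iff_nat vert_eq_iff)
  then show False using \<open>x < y\<close> \<open>y < x + n\<close> dvd_imp_le[of n "y - x"] by auto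
qed

lemma vert_image_window: "vert ` {x..<x + n} = {1..n}"
proof (rule card_subset_eq)
  have "inj_on vert {x..<x + n}"
    by (rule linorder_inj_onI) (use vert_inj_window in auto)
  then show "card (vert ` {x..<x + n}) = card {1..n}" by (simp add: card_image)
qed (use vert_range in auto)

lemma star_periodic [simp]: "star (a + n) = star a" "star (a mod n) = star a"
proof -
  have "vert (a mod n + k + 1) = vert (a + k + 1)" for a
    unfolding vert_eq_iff by (metis Suc_eq_plus1 add.assoc mod_add_left_eq)
  then show "star (a mod n) = star a" for a by (simp add: star_def)
  then show "star (a + n) = star a" by (metis mod_add_self2)
qed

lemma star_low: "a < k + 2 \<Longrightarrow> star a = {a + 1, a + k + 2}"
  using nk by (simp add: star_def vert_def)

lemma star_high:
  assumes "k + 2 \<le> a" "a < n" shows "star a = {a - k - 1, a + 1}"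
proof -
  have "(a + k + 1) mod n = a + k + 1 - n"
    using assms nk by (subst le_mod_geq) auto
  also have "\<dots> = a - k - 2" using assms nk by simp
  finally have "vert (a + k + 1) = Suc (a - k - 2)" by (simp add: vert_def)
  then show ?thesis using assms by (auto simp: star_def vert_def)
qed

text \<open>
  Reduction modulo \<open>n\<close> permutes the three indices cyclically, which preserves the orientation.
\<close>

lemma Q_oriented:
  assumes "x < y" "y < z" "z < x + n"
  shows "s * orient (Q x) (Q y) (Q z) > 0"
proof -
  have base: "s * orient (Q x) (Q y) (Q z) > 0" if "x < y" "y < z" "z < n" for x y z
    using that oriented[of "Suc x" "Suc y" "Suc z"] by (simp add: vert_def)
  have less: "s * orient (Q x) (Q y) (Q z) > 0" if "x < n" "x < y" "y < z" "z < x + n" for x y z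
  proof -
    consider "z < n" | "y < n" "n \<le> z" | "n \<le> y" using that by linarith
    then show ?thesis
    proof cases
      case 1 then show ?thesis using base that by simp
    next
      case 2
      then have "s * orient (Q (z - n)) (Q x) (Q y) > 0" using base[of "z - n" x y] that by simp
      moreover have "vert (z - n) = vert z" using vert_periodic(1)[of "z - n"] 2 by simp
      ultimately show ?thesis by (simp add: orient_rotate)
    next
      case 3
      then have "s * orient (Q (y - n)) (Q (z - n)) (Q x) > 0"
        using base[of "y - n" "z - n" x] that by simp
      moreover have "vert (z - n) = vert z" "vert (y - n) = vert y"
        using vert_periodic(1)[of "z - n"] vert_periodic(1)[of "y - n"] 3 that by simp_all
      ultimately show ?thesis by (simp add: orient_rotate)
    qed
  qed
  define m where "m = x div n"
  have x: "x = x mod n + n * m" by (simp add: m_def)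
  have sub: "vert (t - n * m) = vert t" if "x \<le> t" for t
    using vert_periodic(2)[of "t - n * m" m] that x by (simp del: vert_periodic)
  have "s * orient (Q (x - n * m)) (Q (y - n * m)) (Q (z - n * m)) > 0"
  proof (rule less)
    show "x - n * m < n" using x n_ge by (metis add_diff_cancel_right' mod_less_divisor less_le_trans zero_less_numeral)
  qed (use assms x in linarith)+
  then show ?thesis using sub assms by simp
qed

lemma relevant_eq_star: "rel = star ` {..<n}"
proof
  show "rel \<subseteq> star ` {..<n}"
  proof
    fix e assume "e \<in> rel"
    then have e: "e \<subseteq> {1..n}" "card e = 2" "k + 1 \<le> edge_length n e"
      by (auto simp: relevant_edges_def all_edges_def)
    then obtain i j where ij: "e = {i, j}" "i < j" by (metis card_2_iff insert_commute linorder_neqE_nat)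
    then have "Min e = i" "Max e = j" by auto
    then have "j - i = k + 1 \<or> j - i = k + 2"
      using e ij nk by (auto simp: edge_length_def)
    then show "e \<in> star ` {..<n}"
    proof
      assume d: "j - i = k + 1"
      have "e = star (i - 1)" using star_low[of "i - 1"] d ij e nk by auto
      then show ?thesis using d ij e by auto
    next
      assume d: "j - i = k + 2"
      then have "j = i + k + 2" using ij by simp
      then have "e = star (j - 1)" using star_high[of "j - 1"] ij e nk by auto
      then show ?thesis using d ij e by auto
    qed
  qed
next
  show "star ` {..<n} \<subseteq> rel"
  proof
    fix e assume "e \<in> star ` {..<n}"
    then obtain a where a: "a < n" "e = star a" by auto
    show "e \<in> rel"
    proof (cases "a < k + 2")
      case True
      then have "Min e = a + 1" "Max e = a + k + 2" using a star_low by auto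
      then show ?thesis using True a nk
        by (auto simp: relevant_edges_def all_edges_def edge_length_def star_low)
    next
      case False
      then have "Min e = a - k - 1" "Max e = a + 1" using a star_high by auto
      then show ?thesis using False a nk
        by (auto simp: relevant_edges_def all_edges_def edge_length_def star_high)
    qed
  qed
qed

lemma star_relevant [simp]: "star a \<in> rel"
proof -
  have "star (a mod n) \<in> star ` {..<n}" using n_ge by (intro imageI) simp
  then show ?thesis by (simp add: relevant_eq_star del: image_iff)
qed

lemma relevant_window: "rel = star ` {x..<x + n}"
proof -
  have "star a \<in> star ` {x..<x + n}" for a
  proof -
    have "vert a \<in> vert ` {x..<x + n}" using vert_image_window vert_range by simp
    then obtain b where b: "b \<in> {x..<x + n}" "vert a = vert b" by auto
    then have "star a = star b" by (metis star_periodic(2) vert_eq_iff)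
    then show ?thesis using b by auto
  qed
  then have "star ` {..<n} \<subseteq> star ` {x..<x + n}" by (rule image_subsetI)
  moreover have "star ` {x..<x + n} \<subseteq> rel" by (rule image_subsetI) (rule star_relevant)
  ultimately show ?thesis unfolding relevant_eq_star by (rule equalityI)
qed

lemma finite_rel: "finite rel" by (simp add: relevant_eq_star)

lemma rel_star_cases: assumes "e \<in> rel" obtains a where "a \<ge> n" "e = star a"
  using assms relevant_window[of n] by auto

lemma across_subset: "across u \<subseteq> rel" by (auto simp: across_def)

lemma h_star: "h (star a) p = s * hdet (Q a) (Q (a + k + 1)) p"
proof -
  have base: "h (star a) p = s * hdet (Q a) (Q (a + k + 1)) p" if "a < n" for a
  proof (cases "a < k + 2")
    case True
    then have "Min (star a) = a + 1" "Max (star a) = a + k + 2" using star_low by auto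
    then show ?thesis using True nk by (simp add: h_def vert_def)
  next
    case False
    then have m: "Min (star a) = a - k - 1" "Max (star a) = a + 1" using that star_high by auto
    have "vert a = a + 1" using that by (simp add: vert_def)
    then have "vert (a + k + 1) = a - k - 1"
      using star_high[of a] that False by (auto simp: star_def doubleton_eq_iff)
    then show ?thesis
      using m False \<open>vert a = a + 1\<close> hdet_swap[of "q (a - k - 1)"] by (simp add: h_def)
  qed
  have "h (star (a mod n)) p = s * hdet (Q (a mod n)) (Q (a mod n + k + 1)) p"
    using n_ge by (intro base) simp
  moreover have "vert (a mod n + k + 1) = vert (a + k + 1)"
    unfolding vert_eq_iff by (metis Suc_eq_plus1 add.assoc mod_add_left_eq)
  ultimately show ?thesis by simp
qed

lemma h_linear_simps:
  "h e (p + p') = h e p + h e p'" "h e (p - p') = h e p - h e p'"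
  "h e (r *\<^sub>R p) = r * h e p" "h e (- p) = - h e p" "h e 0 = 0"
  by (simp_all add: h_def hdet_linear_simps algebra_simps)

lemma continuous_on_h: "continuous_on S (h e)"
  unfolding h_def by (intro continuous_intros continuous_on_hdet)

lemma h_vertex: "h (star a) (Q u, 1) = s * orient (Q a) (Q (a + k + 1)) (Q u)"
  by (simp add: h_star hdet_affine)

lemma h_vertex_pos:
  assumes "a + k + 1 < u" "u < a + n" shows "h (star a) (Q u, 1) > 0"
  unfolding h_vertex by (rule Q_oriented) (use assms in auto)

lemma h_across_pos:
  assumes "e \<in> across u" shows "h e (Q u, 1) > 0"
proof -
  obtain a where "a \<in> {u + 1..u + k + 1}" "e = star a" using assms by (auto simp: across_def)
  then show ?thesis using h_vertex_pos[of a "u + n"] nk by auto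
qed

lemma h_vertex_neg:
  assumes "a < u" "u < a + k + 1" shows "h (star a) (Q u, 1) < 0"
proof -
  have "s * orient (Q a) (Q u) (Q (a + k + 1)) > 0"
    by (rule Q_oriented) (use assms nk in auto)
  then show ?thesis
    unfolding h_vertex using orient_swap[of "Q a" "Q (a + k + 1)"] 
    by (metis minus_mult_right neg_less_0_iff_less orient_rotate orient_swap)
qed

lemma h_endpoints [simp]: "h (star a) (Q a, 1) = 0" "h (star a) (Q (a + k + 1), 1) = 0"
  by (simp_all add: h_vertex)

section \<open>Directions seen by a halving vertex\<close>

definition dir :: "nat \<Rightarrow> real \<times> real" where "dir a = Q (a + k + 1) - Q a"

lemma h_direction: "h (star a) (z, 0) = s * cross2 (dir a) z"
  by (simp add: h_star hdet_direction dir_def)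

lemma dir_periodic [simp]: "dir (a + n) = dir a"
proof -
  have "vert (a + n + k + 1) = vert (a + k + 1)" using vert_periodic(1)[of "a + k + 1"]
    by (simp add: algebra_simps)
  then show ?thesis by (simp add: dir_def)
qed

text \<open>
  Two relevant edges cross or share an endpoint; up to the sign \<open>s\<close>, the cross product of
  their directions is twice the area of the quadrilateral, or triangle, spanned by their endpoints.
\<close>

lemma dir_turn:
  assumes "a < b" "b \<le> a + k + 1"
  shows "s * cross2 (dir a) (dir b) > 0"
proof -
  have "cross2 (dir a) (dir b) =
      orient (Q a) (Q b) (Q (a + k + 1)) + orient (Q a) (Q (a + k + 1)) (Q (b + k + 1))"
    by (simp add: dir_def orient_def cross2_def algebra_simps)
  moreover have "s * orient (Q a) (Q (a + k + 1)) (Q (b + k + 1)) > 0"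
    by (rule Q_oriented) (use assms nk in auto)
  moreover have "s * orient (Q a) (Q b) (Q (a + k + 1)) \<ge> 0"
  proof (cases "b = a + k + 1")
    case False
    then show ?thesis using assms nk by (intro less_imp_le Q_oriented) auto
  qed simp
  ultimately show ?thesis by (simp add: distrib_left)
qed

text \<open>
  By \<open>dir_turn\<close> the directed relevant edges are sorted by slope: each of them turns to the next
  \<open>k + 1\<close> ones by less than a half turn. Since they wind around the origin, \<open>z\<close> lies between two
  consecutive ones, \<open>dir x\<close> and \<open>dir (x + 1)\<close>. The \<open>k + 1\<close> edges up to \<open>x\<close> turn to both of these,
  hence to \<open>z\<close>.
\<close>

lemma direction_sees_across:
  assumes z: "z \<noteq> 0"
  shows "\<exists>u. \<forall>e\<in>across u. h e (z, 0) > 0"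
proof -
  define f where "f b = s * cross2 (dir b) z" for b
  have per: "f (b + n) = f b" for b by (simp add: f_def)
  define c where "c a b = s * cross2 (dir a) (dir b)" for a b
  have c: "c 0 (k + 1) > 0" "c (k + 1) (2 * k + 2) > 0" "c (2 * k + 2) n > 0"
    unfolding c_def by (rule dir_turn; use nk in simp)+
  have dn: "dir n = dir 0" using dir_periodic[of 0] by simp
  \<comment> \<open>The three edges of a path of the star polygon are positively dependent.\<close>
  have zero_sum: "c (k + 1) (2 * k + 2) * f 0 + c (2 * k + 2) n * f (k + 1) + c 0 (k + 1) * f (2 * k + 2) = 0"
    unfolding c_def f_def dn cross2_def by algebra
  have not_all: "f 0 \<noteq> 0 \<or> f (k + 1) \<noteq> 0"
  proof (rule ccontr)
    assume "\<not> ?thesis"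
    then have "cross2 (dir 0) z = 0" "cross2 (dir (k + 1)) z = 0" "cross2 (dir 0) (dir (k + 1)) \<noteq> 0"
      using c(1) s_square by (auto simp: f_def c_def)
    then show False using cross2_eq_zero_imp z by blast
  qed
  have "\<exists>a \<le> 2 * k + 2. f a > 0"
  proof (rule ccontr)
    assume "\<not> ?thesis"
    then have "f a \<le> 0" if "a \<le> 2 * k + 2" for a using that by (meson not_less)
    then have "f 0 \<le> 0" "f (k + 1) \<le> 0" "f (2 * k + 2) \<le> 0" by simp_all
    then have "c (k + 1) (2 * k + 2) * f 0 \<le> 0" "c (2 * k + 2) n * f (k + 1) \<le> 0"
       "c 0 (k + 1) * f (2 * k + 2) \<le> 0" using c by (simp_all add: mult_le_0_iff)
    then have "c (k + 1) (2 * k + 2) * f 0 = 0" "c (2 * k + 2) n * f (k + 1) = 0"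
      using zero_sum by linarith+
    then show False using not_all c by auto
  qed
  then obtain a where a: "a \<le> 2 * k + 2" "f a > 0" by blast
  have "\<exists>b. f b \<le> 0"
  proof (rule ccontr)
    assume "\<not> ?thesis"
    then have "f 0 > 0" "f (k + 1) > 0" "f (2 * k + 2) > 0" by (meson not_le)+
    then show False using zero_sum c by (metis add_pos_pos less_irrefl mult_pos_pos)
  qed
  then obtain b where "f b \<le> 0" by blast
  have perm: "f (b + m * n) = f b" for m
  proof (induction m)
    case (Suc m)
    have "b + Suc m * n = b + m * n + n" by simp
    then show ?case using Suc per by metis
  qed simp
  have "(a + 1) * 1 \<le> (a + 1) * n" by (rule mult_le_mono2) (use n_ge in simp)
  then have "a < b + (a + 1) * n" by simp
  moreover have "f (b + (a + 1) * n) \<le> 0" using \<open>f b \<le> 0\<close> unfolding perm .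
  ultimately have "a < b + (a + 1) * n \<and> f (b + (a + 1) * n) \<le> 0" ..
  then have ex: "\<exists>b. a < b \<and> f b \<le> 0" by blast
  define b where "b = (LEAST b. a < b \<and> f b \<le> 0)"
  have b: "a < b" "f b \<le> 0" using LeastI_ex[OF ex] by (auto simp: b_def)
  \<comment> \<open>Adding \<open>n\<close> keeps the window of the \<open>k + 1\<close> indices up to \<open>x\<close> within the natural numbers.\<close>
  define x where "x = b - 1 + n"
  have "f (b - 1) > 0"
  proof (cases "b - 1 = a")
    case False
    then have "a < b - 1" using b by simp
    then show ?thesis using not_less_Least[of "b - 1" "\<lambda>b. a < b \<and> f b \<le> 0"] b by (auto simp: b_def[symmetric])
  qed (use a in simp)
  then have fx: "f x > 0" by (simp add: x_def per)
  have fx1: "f (x + 1) \<le> 0" using b per[of b] by (simp add: x_def)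
  have "f y > 0" if y: "y \<in> {x - k - 1 + 1..x - k - 1 + k + 1}" for y
  proof -
    have xn: "x \<ge> n" by (simp add: x_def)
    have yx: "x - k \<le> y" "y \<le> x" using y xn nk by auto
    have "c x (x + 1) * f y = f x * c y (x + 1) - f (x + 1) * c y x"
      unfolding c_def f_def cross2_def by algebra
    moreover have "c y (x + 1) > 0"
      unfolding c_def by (rule dir_turn) (use yx xn nk in auto)
    moreover have "c y x \<ge> 0"
    proof (cases "y = x")
      case False
      then show ?thesis unfolding c_def by (intro less_imp_le dir_turn) (use yx xn nk in auto)
    qed (simp add: c_def)
    ultimately have "c x (x + 1) * f y > 0"
      using fx fx1 by (smt (verit) mult_nonneg_nonneg mult_pos_pos mult_minus_left)
    moreover have "c x (x + 1) > 0" unfolding c_def by (rule dir_turn) auto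
    ultimately show ?thesis by (simp add: zero_less_mult_iff)
  qed
  then have "\<forall>e\<in>across (x - k - 1). h e (z, 0) > 0"
    by (auto simp: across_def h_direction f_def)
  then show ?thesis by blast
qed

text \<open>
  The difference of a nonpositive multiple of \<open>(P0, 1)\<close> and \<open>x\<close> is a direction along which no form in
  \<open>Z\<close> increases. As \<open>Z\<close> meets every \<open>across u\<close>, this direction is zero by
  \<open>direction_sees_across\<close>, and on a negative multiple of \<open>(P0, 1)\<close> the forms in \<open>Z\<close> would be
  negative.
\<close>

lemma recession:
  assumes p0: "\<And>e. e \<in> rel \<Longrightarrow> h e (P0, 1) > 0"
    and "Z \<subseteq> rel" and hit: "\<And>u. across u \<inter> Z \<noteq> {}"
    and nonneg: "\<And>e. e \<in> Z \<Longrightarrow> h e x \<ge> 0" and "snd x \<le> 0"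
  shows "x = 0"
proof -
  define z where "z = snd x *\<^sub>R (P0, 1) - x"
  have z: "h e z = snd x * h e (P0, 1) - h e x" for e unfolding z_def by (simp only: h_linear_simps)
  have "h e z \<le> 0" if "e \<in> Z" for e
  proof -
    have "snd x * h e (P0, 1) \<le> 0"
      using p0[of e] that \<open>Z \<subseteq> rel\<close> \<open>snd x \<le> 0\<close> by (auto simp: mult_le_0_iff intro: less_imp_le)
    then show ?thesis using nonneg[OF that] by (simp add: z)
  qed
  then have le: "\<And>u. \<exists>e\<in>across u. h e z \<le> 0" using hit by blast
  have "z = (fst z, 0)" by (simp add: z_def prod_eq_iff)
  then have "fst z = 0" using le direction_sees_across[of "fst z"] by (metis not_le)
  then have z0: "z = 0" using \<open>z = (fst z, 0)\<close> by (simp add: prod_eq_iff)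
  obtain e where "e \<in> Z" using hit by blast
  then have "snd x * h e (P0, 1) \<ge> 0" using nonneg z[of e] z0 by (simp add: h_linear_simps)
  then have "snd x = 0" using p0[of e] \<open>e \<in> Z\<close> \<open>Z \<subseteq> rel\<close> \<open>snd x \<le> 0\<close>
    by (meson dual_order.antisym subsetD zero_le_mult_iff not_le)
  then have "z = - x" unfolding z_def \<open>snd x = 0\<close> scaleR_zero_left by simp
  then show ?thesis using z0 by simp
qed

end

section \<open>Crossings, faces and octahedral triangulations\<close>

context star_polygon begin

lemma star_inj:
  assumes "a < b" "b < a + n" shows "star a \<noteq> star b"
proof
  assume eq: "star a = star b"
  have "vert a \<noteq> vert b" using vert_inj_window assms by blast
  then have v: "vert a = vert (b + k + 1)" "vert (a + k + 1) = vert b"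
    using eq by (auto simp: star_def doubleton_eq_iff)
  have "b = a + k + 1"
  proof (rule linorder_cases[of b "a + k + 1"])
    assume "b < a + k + 1"
    then show ?thesis using v(2) vert_inj_window[of b "a + k + 1"] assms nk by simp
  next
    assume "a + k + 1 < b"
    then show ?thesis using v(2) vert_inj_window[of "a + k + 1" b] assms nk by simp
  qed
  then show False using v(1) vert_inj_window[of a "b + k + 1"] nk by auto
qed

lemma star_inj_on: "inj_on star {x..<x + n}"
  by (rule linorder_inj_onI) (use star_inj in auto)

lemma card_across: "card (across u) = k + 1"
proof -
  have "inj_on star {u + 1..u + k + 1}"
    by (rule inj_on_subset[OF star_inj_on[of "u + 1"]]) (use nk in auto)
  then show ?thesis by (simp add: across_def card_image)
qed

lemma finite_across: "finite (across u)" by (simp add: across_def)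

lemma across_mod: "across (u mod n) = across u"
proof -
  have shift: "star (b + n * m) = star b" for b m
  proof (induction m)
    case (Suc m)
    have "b + n * Suc m = b + n * m + n" by simp
    then show ?case using Suc star_periodic(1) by metis
  qed simp
  have "across u = star ` (\<lambda>b. b + n * (u div n)) ` {u mod n + 1..u mod n + k + 1}"
    unfolding across_def image_add_atLeastAtMost' by (simp add: algebra_simps)
  also have "\<dots> = across (u mod n)" by (simp only: image_image shift across_def)
  finally show ?thesis by simp
qed

text \<open>
  The increasing enumeration of the positive numbers other than \<open>u\<close>. Omitting one vertex leaves
  \<open>2k + 2\<close> vertices, and \<open>across\<close> is the perfect matching of these by opposite pairs.
\<close>

definition skip :: "nat \<Rightarrow> nat \<Rightarrow> nat" where "skip u t = (if t < u then t else Suc t)"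

lemma skip_mono: "t < t' \<Longrightarrow> skip u t < skip u t'"
  by (auto simp: skip_def)

lemma across_eq_matching:
  assumes u: "u < n"
  shows "across u = (\<lambda>t. {skip (u + 1) t, skip (u + 1) (t + k + 1)}) ` {1..k + 1}" (is "_ = ?m ` _")
proof (rule card_subset_eq[symmetric])
  show "finite (across u)" by (rule finite_across)
  have "inj_on ?m {1..k + 1}"
  proof (rule inj_onI)
    fix t t' assume "?m t = ?m t'"
    then have "Min (?m t) = Min (?m t')" by simp
    moreover have "Min (?m t) = skip (u + 1) t" for t
      using skip_mono[of t "t + k + 1" "u + 1"] by auto
    ultimately show "t = t'"
      using skip_mono[of t t' "u + 1"] skip_mono[of t' t "u + 1"] by (metis linorder_neqE_nat less_irrefl)
  qed
  then show "card (?m ` {1..k + 1}) = card (across u)"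
    by (simp add: card_across card_image)
  show "?m ` {1..k + 1} \<subseteq> across u"
  proof
    fix e assume "e \<in> ?m ` {1..k + 1}"
    then obtain t where t: "1 \<le> t" "t \<le> k + 1" "e = ?m t" by auto
    have "\<exists>b\<in>{u + 1..u + k + 1}. e = star b"
    proof -
      consider "t + k + 1 \<le> u" | "u + 1 \<le> t" | "t \<le> u" "u < t + k + 1" by linarith
      then show ?thesis
      proof cases
        case 1
        then have "e = star (t - 1)" using t star_low[of "t - 1"] by (simp add: skip_def)
        then have "e = star (t - 1 + n)" by simp
        moreover have "t - 1 + n \<in> {u + 1..u + k + 1}" using 1 t u nk by auto
        ultimately show ?thesis by blast
      next
        case 2
        then have "e = star t" using t star_low[of t] by (simp add: skip_def)
        then show ?thesis using 2 t by auto
      next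
        case 3
        then have "e = star (t + k + 1)" using t star_high[of "t + k + 1"] nk by (simp add: skip_def)
        then show ?thesis using 3 t by auto
      qed
    qed
    then show "e \<in> across u" by (auto simp: across_def)
  qed
qed

lemma across_crossing: "pairwise crosses (across u)"
proof -
  have "pairwise crosses (across u)" if "u < n" for u
    unfolding across_eq_matching[OF that]
  proof (rule pairwiseI)
    fix e f
    let ?w = "skip (u + 1)"
    assume "e \<in> (\<lambda>t. {?w t, ?w (t + k + 1)}) ` {1..k + 1}" "f \<in> (\<lambda>t. {?w t, ?w (t + k + 1)}) ` {1..k + 1}" "e \<noteq> f"
    then obtain t t' where t: "t \<in> {1..k + 1}" "t' \<in> {1..k + 1}"
        "e = {?w t, ?w (t + k + 1)}" "f = {?w t', ?w (t' + k + 1)}" by blast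
    then have "t \<noteq> t'" using \<open>e \<noteq> f\<close> by auto
    have "?w t < ?w (t + k + 1)" "?w t' < ?w (t' + k + 1)" "?w t < ?w (t' + k + 1)" "?w t' < ?w (t + k + 1)"
      using t by (auto intro!: skip_mono)
    moreover have "?w t < ?w t' \<and> ?w (t + k + 1) < ?w (t' + k + 1) \<or> ?w t' < ?w t \<and> ?w (t' + k + 1) < ?w (t + k + 1)"
      using \<open>t \<noteq> t'\<close> by (metis add_less_cancel_right linorder_neqE_nat skip_mono)
    ultimately show "crosses e f" unfolding crosses_def t(3,4) by blast
  qed
  then show ?thesis using across_mod[of u] n_ge by (metis mod_less_divisor less_le_trans zero_less_numeral)
qed

text \<open>
  Pairwise crossing edges are disjoint, so \<open>k + 1\<close> of them miss exactly one vertex \<open>U\<close>. Every one of them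
  separates the endpoints of the \<open>k\<close> others, which fixes the number of vertices between its
  endpoints up to the position of \<open>U\<close>.
\<close>

lemma crossing_set_eq_across:
  assumes S: "S \<subseteq> all_edges n" "card S = k + 1" "pairwise crosses S"
  shows "\<exists>u. S = across u"
proof -
  have fin: "finite S" using S(2) by (metis add_is_0 card.infinite one_neq_zero)
  have edge: "\<exists>i j. e = {i, j} \<and> i < j \<and> 1 \<le> i \<and> j \<le> n" if "e \<in> S" for e
  proof -
    have "e \<subseteq> {1..n}" "card e = 2" using S(1) that by (auto simp: all_edges_def)
    then obtain i j where "e = {i, j}" "i < j" by (metis card_2_iff insert_commute linorder_neqE_nat)
    then show ?thesis using \<open>e \<subseteq> {1..n}\<close> by auto
  qed
  have cross: "e \<inter> f = {}" "\<exists>v. f \<inter> {i<..<j} = {v}"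
    if "e \<in> S" "f \<in> S" "e \<noteq> f" "e = {i, j}" "i < j" for e f i j
  proof -
    have "crosses e f" using S(3) that by (auto simp: pairwise_def)
    then obtain i' j' a b where c: "e = {i', j'}" "f = {a, b}" "i' < j'" "a < b"
       "i' < a \<and> a < j' \<and> j' < b \<or> a < i' \<and> i' < b \<and> b < j'"
      unfolding crosses_def by blast
    then have ij: "i' = i" "j' = j" using that by (auto simp: doubleton_eq_iff)
    show "e \<inter> f = {}" using c by auto
    have "f \<inter> {i<..<j} = {a} \<or> f \<inter> {i<..<j} = {b}" using c ij by auto
    then show "\<exists>v. f \<inter> {i<..<j} = {v}" by blast
  qed
  have card2: "finite e \<and> card e = 2" if "e \<in> S" for e
    using S(1) that finite_subset[of e "{1..n}"] by (auto simp: all_edges_def)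
  have disj: "e \<inter> f = {}" if "e \<in> S" "f \<in> S" "e \<noteq> f" for e f
    using edge[OF that(1)] cross(1)[OF that] by blast
  have "card (\<Union> S) = sum card S"
    by (rule card_Union_disjoint) (use disj card2 in \<open>auto simp: pairwise_def disjnt_def\<close>)
  also have "\<dots> = 2 * (k + 1)" using card2 S(2) by simp
  finally have cV: "card (\<Union> S) = 2 * k + 2" by simp
  have VV: "\<Union> S \<subseteq> {1..n}" using S(1) by (auto simp: all_edges_def)
  then have "card ({1..n} - \<Union> S) = 1"
    using cV nk by (subst card_Diff_subset) (auto intro: finite_subset)
  then obtain U where U: "{1..n} - \<Union> S = {U}" by (auto simp: card_1_singleton_iff)
  then have U1: "1 \<le> U" "U \<le> n" "U \<notin> \<Union> S" by auto
  have "S \<subseteq> across (U - 1)"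
  proof
    fix e assume e: "e \<in> S"
    then obtain i j where ij: "e = {i, j}" "i < j" "1 \<le> i" "j \<le> n" using edge by blast
    have iU: "i \<noteq> U" "j \<noteq> U" using e ij U1 by auto
    have "\<exists>v. f \<inter> {i<..<j} = {v}" if "f \<in> S - {e}" for f
      using cross(2)[OF e _ _ ij(1,2)] that by auto
    then have one: "card (f \<inter> {i<..<j}) = 1" if "f \<in> S - {e}" for f using that by fastforce
    have "\<Union> S \<inter> {i<..<j} = (\<Union>f\<in>S - {e}. f \<inter> {i<..<j})" using ij e by auto
    also have "card \<dots> = (\<Sum>f\<in>S - {e}. card (f \<inter> {i<..<j}))"
      by (rule card_UN_disjoint) (use fin disj in auto)
    also have "\<dots> = k" using one e S(2) fin by simp
    finally have ck: "card (\<Union> S \<inter> {i<..<j}) = k" .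
    have "{i<..<j} = (\<Union> S \<inter> {i<..<j}) \<union> ({U} \<inter> {i<..<j})"
    proof -
      have "{i<..<j} \<subseteq> {1..n}" using ij by auto
      then show ?thesis using U by blast
    qed
    moreover have "card ((\<Union> S \<inter> {i<..<j}) \<union> ({U} \<inter> {i<..<j})) = k + card ({U} \<inter> {i<..<j})"
      unfolding ck[symmetric] by (rule card_Un_disjoint) (use U1 in auto)
    ultimately have len: "j - i - 1 = k + card ({U} \<inter> {i<..<j})"
      by (metis card_greaterThanLessThan diff_diff_left Suc_eq_plus1 add.commute)
    define t where "t = (if i < U then i else i - 1)"
    have "e = {skip U t, skip U (t + k + 1)} \<and> t \<in> {1..k + 1}"
    proof (cases "i < U \<and> U < j")
      case True
      then have "{U} \<inter> {i<..<j} = {U}" by auto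
      then have "j = i + k + 2" using len ij by simp
      then show ?thesis using True ij nk by (auto simp: t_def skip_def)
    next
      case False
      then have "{U} \<inter> {i<..<j} = {}" by auto
      then have "j = i + k + 1" using len ij by simp
      then show ?thesis using False ij nk iU U1 by (auto simp: t_def skip_def)
    qed
    then have "e \<in> (\<lambda>t. {skip U t, skip U (t + k + 1)}) ` {1..k + 1}" by blast
    then show "e \<in> across (U - 1)" using across_eq_matching[of "U - 1"] U1 by simp
  qed
  then have "S = across (U - 1)"
    using card_subset_eq[OF finite_across] S(2) card_across by metis
  then show ?thesis by blast
qed

lemma rel_subset_all: "rel \<subseteq> all_edges n" by (auto simp: relevant_edges_def)

lemma crossing_free_iff:
  assumes "E \<subseteq> all_edges n"
  shows "crossing_free k E \<longleftrightarrow> (\<forall>u. \<not> across u \<subseteq> E)"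
proof -
  have "(\<exists>S\<subseteq>E. card S = k + 1 \<and> pairwise crosses S) \<longleftrightarrow> (\<exists>u. across u \<subseteq> E)"
    using crossing_set_eq_across assms card_across across_crossing by (metis order_trans)
  then show ?thesis unfolding crossing_free_def by simp
qed

lemma face_iff: "F \<in> reduced_complex k n \<longleftrightarrow> F \<subseteq> rel \<and> (\<forall>u. \<not> across u \<subseteq> F)"
  using crossing_free_iff rel_subset_all unfolding reduced_complex_def by blast

text \<open>
  A short edge belongs to no set of \<open>k + 1\<close> pairwise crossing edges, so by maximality it lies in
  every \<open>k\<close>-triangulation.
\<close>

lemma k_triangulation_complement:
  assumes "k_triangulation k n T" shows "all_edges n - T \<subseteq> rel"
proof
  fix e assume e: "e \<in> all_edges n - T"
  show "e \<in> rel"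
  proof (rule ccontr)
    assume "e \<notin> rel"
    have T: "T \<subseteq> all_edges n" "crossing_free k T"
      and max: "\<And>T'. T \<subseteq> T' \<Longrightarrow> T' \<subseteq> all_edges n \<Longrightarrow> crossing_free k T' \<Longrightarrow> T' = T"
      using assms by (auto simp: k_triangulation_def)
    have "across u \<subseteq> T" if "across u \<subseteq> insert e T" for u
      using that across_subset[of u] \<open>e \<notin> rel\<close> by blast
    then have "crossing_free k (insert e T)"
      using T e crossing_free_iff by (metis Diff_iff insert_subset)
    then show False using max[of "insert e T"] T e by auto
  qed
qed

lemma adjacent_stars:
  assumes "e \<in> rel" "f \<in> rel" "e \<noteq> f" "e \<inter> f \<noteq> {}"
  obtains a where "e = star a \<and> f = star (a + k + 1) \<or> f = star a \<and> e = star (a + k + 1)"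
proof -
  obtain a where a: "e = star a" using assms rel_star_cases by metis
  obtain b where b: "b \<in> {a..<a + n}" "f = star b" using assms relevant_window[of a] by blast
  then have ab: "a < b" "b < a + n" using assms a by (auto simp: order.order_iff_strict)
  have ne: "vert a \<noteq> vert b" "vert (a + k + 1) \<noteq> vert (b + k + 1)"
    using vert_inj_window[OF ab] vert_inj_window[of "a + k + 1" "b + k + 1"] ab by auto
  have "vert a = vert (b + k + 1) \<or> vert (a + k + 1) = vert b"
    using assms(4) ne a b by (auto simp: star_def)
  then show thesis
  proof
    assume v: "vert a = vert (b + k + 1)"
    then have v': "vert (a + n) = vert (b + k + 1)" by simp
    have "\<not> a + n < b + k + 1" using vert_inj_window[of "a + n" "b + k + 1"] v' ab nk by auto
    moreover have "\<not> b + k + 1 < a + n" using vert_inj_window[of "b + k + 1" "a + n"] v' ab nk by auto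
    ultimately have "a + n = b + k + 1" by simp
    then have "star a = star (b + k + 1)" by (metis star_periodic(1))
    then show thesis using that a b by blast
  next
    assume v: "vert (a + k + 1) = vert b"
    have "\<not> a + k + 1 < b" using vert_inj_window[of "a + k + 1" b] v ab nk by auto
    moreover have "\<not> b < a + k + 1" using vert_inj_window[of b "a + k + 1"] v ab nk by auto
    ultimately have "b = a + k + 1" by simp
    then show thesis using that a b by blast
  qed
qed

text \<open>
  If \<open>across u\<close> avoids \<open>Z\<close>, then \<open>Z\<close> lies in the \<open>k + 2\<close> remaining consecutive edges of the star polygon. The
  first and the last of these share an endpoint, and leaving out either of them gives another
  set \<open>across u'\<close>; both are excluded. For maximality, two edges of the star polygon cut it into two
  arcs, one of which contains \<open>k + 1\<close> consecutive edges.
\<close>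

lemma octahedral_complement:
  assumes Z: "Z \<subseteq> rel" "card Z = 3" and notin: "\<And>u. \<not> Z \<subseteq> across u"
    and disj: "\<And>e f. e \<in> Z \<Longrightarrow> f \<in> Z \<Longrightarrow> e \<noteq> f \<Longrightarrow> e \<inter> f = {}"
  shows "octahedral k (all_edges n - Z)"
proof -
  let ?T = "all_edges n - Z"
  have compl: "all_edges n - ?T = Z" using Z rel_subset_all by blast
  have "card (\<Union> Z) = sum card Z"
    by (rule card_Union_disjoint)
       (use Z disj rel_subset_all finite_subset[of _ "{1..n}"] in
         \<open>auto simp: pairwise_def disjnt_def all_edges_def\<close>)
  also have "\<dots> = (\<Sum>e\<in>Z. 2)"
    by (rule sum.cong) (use Z rel_subset_all in \<open>auto simp: all_edges_def\<close>)
  finally have six: "card (\<Union> (all_edges n - ?T)) = 6" using Z compl by simp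
  have free: "crossing_free k ?T"
    unfolding crossing_free_iff[OF Diff_subset]
  proof (intro allI notI)
    fix u assume u: "across u \<subseteq> ?T"
    have "rel = star ` {u + 1..<u + 1 + n}" by (rule relevant_window)
    then have "rel \<subseteq> across u \<union> star ` {u + k + 2..u + 2 * k + 3}"
      unfolding across_def using nk by (force simp: image_iff)
    then have Zw: "Z \<subseteq> star ` {u + k + 2..u + 2 * k + 3}" using Z u by blast
    have "star (u + k + 2) \<in> Z"
    proof (rule ccontr)
      assume n1: "star (u + k + 2) \<notin> Z"
      have "Z \<subseteq> across (u + k + 2)"
      proof
        fix e assume "e \<in> Z"
        then obtain b where b: "b \<in> {u + k + 2..u + 2 * k + 3}" "e = star b" using Zw by blast
        then have "b \<noteq> u + k + 2" using n1 \<open>e \<in> Z\<close> by auto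
        then show "e \<in> across (u + k + 2)" using b unfolding across_def by auto
      qed
      then show False using notin by blast
    qed
    moreover have "star (u + 2 * k + 3) \<in> Z"
    proof (rule ccontr)
      assume n1: "star (u + 2 * k + 3) \<notin> Z"
      have "Z \<subseteq> across (u + k + 1)"
      proof
        fix e assume "e \<in> Z"
        then obtain b where b: "b \<in> {u + k + 2..u + 2 * k + 3}" "e = star b" using Zw by blast
        then have "b \<noteq> u + 2 * k + 3" using n1 \<open>e \<in> Z\<close> by auto
        then show "e \<in> across (u + k + 1)" using b unfolding across_def by auto
      qed
      then show False using notin by blast
    qed
    moreover have "star (u + k + 2) \<noteq> star (u + 2 * k + 3)"
      by (rule star_inj) (use nk in auto)
    moreover have "vert (u + k + 2 + k + 1) = vert (u + 2 * k + 3)" by (simp add: vert_def algebra_simps numeral_eq_Suc)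
    then have "star (u + k + 2) \<inter> star (u + 2 * k + 3) \<noteq> {}" by (auto simp: star_def)
    ultimately show False using disj by blast
  qed
  have max: "T' = ?T" if T': "?T \<subseteq> T'" "T' \<subseteq> all_edges n" "crossing_free k T'" for T'
  proof (rule ccontr)
    assume "T' \<noteq> ?T"
    then obtain e where e: "e \<in> Z" "e \<in> T'" using T' by blast
    have "card (Z - {e}) = 2" using e Z by simp
    then obtain f g where fg: "Z - {e} = {f, g}" by (auto simp: card_2_iff)
    then obtain b where b: "f = star b" using Z rel_star_cases by (metis Diff_subset insertI1 subsetD)
    have ne: "star x \<noteq> star y" if "b \<le> x" "x < y" "y \<le> b + 2 * k + 2" for x y
      by (rule star_inj) (use that nk in auto)
    have avoid: "star b \<notin> star ` X" if X: "\<forall>y\<in>X. b < y \<and> y \<le> b + 2 * k + 2" for X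
    proof
      assume "star b \<in> star ` X"
      then obtain y where "y \<in> X" "star b = star y" by blast
      then show False using ne[of b y] X by auto
    qed
    have notf: "f \<notin> across b" "f \<notin> across (b + k + 1)"
      unfolding across_def b by (rule avoid; force)+
    have "across b \<inter> across (b + k + 1) = {}"
    proof (rule ccontr)
      assume "\<not> ?thesis"
      then obtain g where "g \<in> across b" "g \<in> across (b + k + 1)" by blast
      then obtain x y where xy: "x \<in> {b + 1..b + k + 1}" "y \<in> {b + k + 1 + 1..b + k + 1 + k + 1}"
          and "g = star x" "g = star y"
        unfolding across_def by blast
      then have "star x = star y" by simp
      moreover have "b \<le> x" "x < y" "y \<le> b + 2 * k + 2" using xy by auto
      ultimately show False using ne[of x y] by blast
    qed
    then obtain u where u: "f \<notin> across u" "g \<notin> across u" using notf by blast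
    have "across u \<subseteq> T'"
    proof
      fix x assume x: "x \<in> across u"
      then have "x \<in> all_edges n" using across_subset[of u] rel_subset_all by (meson subsetD)
      moreover have "x \<notin> Z - {e}" using x u unfolding fg by auto
      ultimately show "x \<in> T'" using e(2) T'(1) by (cases "x = e") auto
    qed
    then show False using T'(3) crossing_free_iff[OF T'(2)] by blast
  qed
  have "k_triangulation k n ?T" unfolding k_triangulation_def using free max by blast
  then show ?thesis using six unfolding octahedral_def n_def by simp
qed

end

section \<open>Big half-planes and Helly's theorem\<close>

lemma affine_hull_pair:
  assumes "a \<noteq> b" shows "affine hull {a, b} = {z. orient a b z = 0}"
proof (intro equalityI subsetI)
  fix z assume "z \<in> affine hull {a, b}"
  then obtain u v where z: "z = u *\<^sub>R a + v *\<^sub>R b" "u + v = 1" by (auto simp: affine_hull_2)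
  then have "u = 1 - v" by simp
  then have "orient a b z = 0" unfolding z(1) by (simp add: orient_affine)
  then show "z \<in> {z. orient a b z = 0}" by simp
next
  fix z assume "z \<in> {z. orient a b z = 0}"
  then obtain w where "z - a = w *\<^sub>R (b - a)"
    using cross2_zero_imp_parallel[of "b - a" "z - a"] assms by (auto simp: orient_def)
  then have "z = (1 - w) *\<^sub>R a + w *\<^sub>R b" by (simp add: algebra_simps)
  then show "z \<in> affine hull {a, b}" unfolding affine_hull_2
    by (intro CollectI exI[of _ "1 - w"] exI[of _ w]) simp
qed

text \<open>
  A line determines its defining equation up to a nonzero factor, so only the two sides given by
  \<open>orient\<close> are possible.
\<close>

lemma bounded_by_line_pair:
  assumes "a \<noteq> b"
  shows "bounded_by_line {z. orient a b z = 0} H \<longleftrightarrow>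
    H = {z. orient a b z > 0} \<or> H = {z. orient a b z < 0}"
proof -
  define N where "N = (- snd (b - a), fst (b - a))"
  have N: "orient a b z = N \<bullet> z - N \<bullet> a" for z
    by (simp add: N_def orient_def cross2_def inner_prod_def algebra_simps)
  have N0: "N \<noteq> 0" using assms by (auto simp: N_def prod_eq_iff)
  show ?thesis
  proof
    assume "bounded_by_line {z. orient a b z = 0} H"
    then obtain u c where u: "u \<noteq> 0" "{z. orient a b z = 0} = {z. u \<bullet> z = c}" "H = {z. u \<bullet> z > c}"
      unfolding bounded_by_line_def by blast
    have "orient a b a = 0" "orient a b b = 0" by simp_all
    then have ab: "u \<bullet> a = c" "u \<bullet> b = c" using u(2) by blast+
    have "cross2 N u = - (u \<bullet> (b - a))"
      by (simp add: N_def cross2_def inner_prod_def algebra_simps)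
    then have "cross2 N u = 0" using ab by (simp add: inner_diff_right)
    then obtain w where w: "u = w *\<^sub>R N" using cross2_zero_imp_parallel N0 by blast
    then have "w \<noteq> 0" using u by auto
    have "u \<bullet> z - c = w * orient a b z" for z
      using ab w by (simp add: N algebra_simps)
    then have "c < u \<bullet> z \<longleftrightarrow> w * orient a b z > 0" for z using diff_gt_0_iff_gt[of "u \<bullet> z" c] by metis
    then have "H = {z. w * orient a b z > 0}" using u(3) by simp
    then show "H = {z. orient a b z > 0} \<or> H = {z. orient a b z < 0}"
      using \<open>w \<noteq> 0\<close> by (cases "w > 0") (auto simp: zero_less_mult_iff)
  next
    assume "H = {z. orient a b z > 0} \<or> H = {z. orient a b z < 0}"
    then show "bounded_by_line {z. orient a b z = 0} H"
    proof
      assume "H = {z. orient a b z > 0}"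
      then show ?thesis
        unfolding bounded_by_line_def N using N0 by (intro exI[of _ N] exI[of _ "N \<bullet> a"]) auto
    next
      assume "H = {z. orient a b z < 0}"
      then show ?thesis
        unfolding bounded_by_line_def N using N0 by (intro exI[of _ "- N"] exI[of _ "- (N \<bullet> a)"]) auto
    qed
  qed
qed

context star_polygon begin

lemma h_affine_comb:
  "h e ((1 - t) *\<^sub>R x + t *\<^sub>R y, 1) = (1 - t) * h e (x, 1) + t * h e (y, 1)"
proof -
  have "((1 - t) *\<^sub>R x + t *\<^sub>R y, 1 :: real) = (1 - t) *\<^sub>R (x, 1) + t *\<^sub>R (y, 1)" by simp
  then show ?thesis by (simp only: h_linear_simps)
qed

lemma card_vertices_of_sign:
  "card {i \<in> {1..n}. h (star a) (q i, 1) > 0} = k + 1"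
  "card {i \<in> {1..n}. h (star a) (q i, 1) < 0} = k"
proof -
  have inj: "inj_on vert {a..<a + n}"
    by (rule linorder_inj_onI) (use vert_inj_window in auto)
  have sgn: "h (star a) (Q t, 1) > 0 \<longleftrightarrow> t \<in> {a + k + 2..<a + n}"
      "h (star a) (Q t, 1) < 0 \<longleftrightarrow> t \<in> {a + 1..<a + k + 1}" if t: "t \<in> {a..<a + n}" for t
  proof -
    consider "t = a" | "a < t" "t < a + k + 1" | "t = a + k + 1" | "a + k + 1 < t" "t < a + n"
      using t by fastforce
    then have "(h (star a) (Q t, 1) > 0 \<longleftrightarrow> t \<in> {a + k + 2..<a + n}) \<and>
        (h (star a) (Q t, 1) < 0 \<longleftrightarrow> t \<in> {a + 1..<a + k + 1})"
    proof cases
      case 1 then show ?thesis by simp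
    next
      case 2
      have "h (star a) (Q t, 1) < 0" by (rule h_vertex_neg) (use 2 in auto)
      then show ?thesis using 2 by simp
    next
      case 3
      then have "h (star a) (Q t, 1) = 0" using h_endpoints(2)[of a] by simp
      then show ?thesis using 3 by simp
    next
      case 4
      have "h (star a) (Q t, 1) > 0" by (rule h_vertex_pos) (use 4 in auto)
      then show ?thesis using 4 by simp
    qed
    then show "h (star a) (Q t, 1) > 0 \<longleftrightarrow> t \<in> {a + k + 2..<a + n}"
      "h (star a) (Q t, 1) < 0 \<longleftrightarrow> t \<in> {a + 1..<a + k + 1}" by blast+
  qed
  have count: "card {i \<in> {1..n}. P (q i)} = card W"
    if W: "W \<subseteq> {a..<a + n}" and P: "\<And>t. t \<in> {a..<a + n} \<Longrightarrow> P (Q t) \<longleftrightarrow> t \<in> W" for P W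
  proof -
    have "{i \<in> {1..n}. P (q i)} = vert ` W"
      unfolding vert_image_window[of a, symmetric] using W P by blast
    then show ?thesis using inj_on_subset[OF inj W] by (simp add: card_image)
  qed
  have "{a + k + 2..<a + n} \<subseteq> {a..<a + n}" by auto
  from count[OF this sgn(1)] show "card {i \<in> {1..n}. h (star a) (q i, 1) > 0} = k + 1"
    using nk by simp
  have "{a + 1..<a + k + 1} \<subseteq> {a..<a + n}" using nk by auto
  from count[OF this sgn(2)] show "card {i \<in> {1..n}. h (star a) (q i, 1) < 0} = k"
    by simp
qed

lemma big_half_plane_eq:
  assumes "e \<in> rel" shows "big_half_plane k q e = {z. h e (z, 1) > 0}"
proof -
  obtain a where a: "e = star a" using assms rel_star_cases by metis
  define A B where "A = Q a" and "B = Q (a + k + 1)"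
  have hz: "h e (z, 1) = s * orient A B z" for z by (simp add: a h_star hdet_affine A_def B_def)
  have "A \<noteq> B"
  proof
    assume "A = B"
    then show False using h_vertex_pos[of a "a + k + 2"] nk unfolding a[symmetric] hz by simp
  qed
  have s: "s = 1 \<or> s = -1" using s_square by (metis mult_cancel_left2 square_eq_1_iff)
  have sides: "bounded_by_line (affine hull (q ` e)) H \<longleftrightarrow>
      H = {z. h e (z, 1) > 0} \<or> H = {z. h e (z, 1) < 0}" for H
  proof -
    have "q ` e = {A, B}" by (simp add: a star_def A_def B_def)
    then show ?thesis
      using affine_hull_pair[OF \<open>A \<noteq> B\<close>] bounded_by_line_pair[OF \<open>A \<noteq> B\<close>, of H] s
      by (auto simp: hz)
  qed
  have cards: "card {i \<in> {1..n}. h e (q i, 1) > 0} = k + 1" "card {i \<in> {1..n}. h e (q i, 1) < 0} = k"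
    unfolding a by (rule card_vertices_of_sign)+
  show ?thesis
    unfolding big_half_plane_def n_def[symmetric]
  proof (rule the_equality)
    fix H assume H: "bounded_by_line (affine hull (q ` e)) H \<and> card {i \<in> {1..n}. q i \<in> H} = k + 1"
    then have "H = {z. h e (z, 1) > 0} \<or> H = {z. h e (z, 1) < 0}" using sides by blast
    then show "H = {z. h e (z, 1) > 0}"
      using H cards by auto
  qed (use sides cards in auto)
qed

lemma convex_big_half_plane:
  assumes "e \<in> rel" shows "convex (big_half_plane k q e)"
  unfolding big_half_plane_eq[OF assms]
proof (rule convexI)
  fix x y and u v :: real
  assume xy: "x \<in> {z. h e (z, 1) > 0}" "y \<in> {z. h e (z, 1) > 0}" and uv: "0 \<le> u" "0 \<le> v" "u + v = 1"
  have u: "u = 1 - v" using uv by simp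
  have "(1 - v) * h e (x, 1) + v * h e (y, 1) > 0"
    using xy uv u by (cases "v = 0") (auto intro!: add_nonneg_pos mult_pos_pos simp: less_imp_le)
  then show "u *\<^sub>R x + v *\<^sub>R y \<in> {z. h e (z, 1) > 0}" unfolding u mem_Collect_eq h_affine_comb .
qed

text \<open>
  Helly's theorem quantifies over sets of convex sets; injectivity makes a triple of half-planes
  come from a triple of edges.
\<close>

lemma inj_on_big_half_plane: "inj_on (big_half_plane k q) rel"
proof -
  have neq: "big_half_plane k q (star a) \<noteq> big_half_plane k q (star b)" if "a < b" "b \<le> a + k + 1" for a b
  proof -
    have "Q a \<in> big_half_plane k q (star b)"
      using h_vertex_pos[of b "a + n"] that nk by (simp add: big_half_plane_eq)
    moreover have "Q a \<notin> big_half_plane k q (star a)" by (simp add: big_half_plane_eq)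
    ultimately show ?thesis by blast
  qed
  have "inj_on (\<lambda>a. big_half_plane k q (star a)) {0..<0 + n}"
  proof (rule linorder_inj_onI)
    fix a b assume ab: "a < b" "a \<in> {0..<0 + n}" "b \<in> {0..<0 + n}"
    show "big_half_plane k q (star a) \<noteq> big_half_plane k q (star b)"
    proof (cases "b \<le> a + k + 1")
      case True
      then show ?thesis using neq ab by blast
    next
      case False
      then have "b < a + n" "a + n \<le> b + k + 1" using ab nk by auto
      then have "big_half_plane k q (star b) \<noteq> big_half_plane k q (star (a + n))" by (rule neq)
      then show ?thesis unfolding star_periodic by (rule not_sym)
    qed
  qed auto
  then have "inj_on (big_half_plane k q \<circ> star) {0..<0 + n}" unfolding comp_def .
  then show ?thesis unfolding relevant_window[of 0] by (rule inj_on_imageI)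
qed

text \<open>
  The third edge has \<open>Q a\<close> or the common endpoint of the first two edges in its big half-plane. Both
  points lie in the closed big half-planes of the first two edges, and moving slightly towards a point
  \<open>Y\<close> in the two open ones gives a common point of all three.
\<close>

lemma adjacent_triple_meets:
  assumes e: "e \<in> rel" "e \<noteq> star a" "e \<noteq> star (a + k + 1)"
  shows "\<exists>z. h (star a) (z, 1) > 0 \<and> h (star (a + k + 1)) (z, 1) > 0 \<and> h e (z, 1) > 0"
proof -
  define c d where "c = a + k + 1" and "d = a + 2 * k + 2"
  have ad: "h (star a) (Q d, 1) > 0"
    by (rule h_vertex_pos) (use nk d_def in auto)
  have "h (star c) (Q (a + n), 1) > 0"
    by (rule h_vertex_pos) (use nk c_def in auto)
  then have ca: "h (star c) (Q a, 1) > 0" by simp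
  have "c + k + 1 = d" by (simp add: c_def d_def)
  then have cd: "h (star c) (Q d, 1) = 0" "h (star c) (Q c, 1) = 0" using h_endpoints[of c] by simp_all
  have aa: "h (star a) (Q a, 1) = 0" "h (star a) (Q c, 1) = 0"
    unfolding c_def by (rule h_endpoints)+
  define Y where "Y = (1 - 1/2) *\<^sub>R Q a + (1/2 :: real) *\<^sub>R Q d"
  have Y: "h (star a) (Y, 1) > 0" "h (star c) (Y, 1) > 0"
    unfolding Y_def h_affine_comb using ad ca cd aa by simp_all
  obtain b where b: "b \<in> {a..<a + n}" "e = star b" using e(1) relevant_window[of a] by blast
  have "e \<in> across a \<or> e \<in> across c"
  proof -
    have "b \<in> {a + 1..a + k + 1} \<or> b \<in> {c + 1..c + k + 1}"
      using b e nk by (cases "b = a") (auto simp: c_def)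
    then show ?thesis using b by (auto simp: across_def)
  qed
  then obtain X where X: "h e (X, 1) > 0" "h (star a) (X, 1) \<ge> 0" "h (star c) (X, 1) \<ge> 0"
    using h_across_pos[of e a] h_across_pos[of e c] aa cd ca by fastforce
  define x y where "x = h e (X, 1)" and "y = h e (Y, 1)"
  \<comment> \<open>The step is so small that the value of \<open>h e\<close> drops at most from \<open>x\<close> to \<open>x / 2\<close>.\<close>
  define t where "t = x / (2 * (x + \<bar>y\<bar>))"
  have "x > 0" using X by (simp add: x_def)
  then have t: "0 < t" "t < 1" by (auto simp: t_def field_simps)
  have half: "r / (2 * c) * c = r / 2" if "c > 0" for r c :: real using that by simp
  have "t * (x + \<bar>y\<bar>) = x / 2" unfolding t_def by (rule half) (use \<open>x > 0\<close> in simp)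
  moreover have "(1 - t) * x + t * y \<ge> x - t * (x + \<bar>y\<bar>)"
    using t mult_left_mono[of "- \<bar>y\<bar>" y t] by (simp add: algebra_simps) linarith
  ultimately have "(1 - t) * x + t * y > 0" using \<open>x > 0\<close> by simp
  then have "h e ((1 - t) *\<^sub>R X + t *\<^sub>R Y, 1) > 0" unfolding h_affine_comb x_def y_def .
  moreover have "h f ((1 - t) *\<^sub>R X + t *\<^sub>R Y, 1) > 0" if "h f (X, 1) \<ge> 0" "h f (Y, 1) > 0" for f
    unfolding h_affine_comb using that t by (simp add: add_nonneg_pos)
  ultimately show ?thesis using X Y unfolding c_def by blast
qed

lemma triple_meets:
  assumes oct: "\<And>T. octahedral k T \<Longrightarrow> (\<Inter>e\<in>all_edges n - T. big_half_plane k q e) \<noteq> {}"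
    and Z: "Z \<subseteq> rel" "card Z = 3"
  shows "(\<Inter>e\<in>Z. big_half_plane k q e) \<noteq> {}"
proof (rule ccontr)
  assume "\<not> ?thesis"
  then have empty: "(\<Inter>e\<in>Z. big_half_plane k q e) = {}" by simp
  have none: "\<exists>e\<in>Z. h e (z, 1) \<le> 0" for z
  proof (rule ccontr)
    assume "\<not> ?thesis"
    then have "z \<in> (\<Inter>e\<in>Z. big_half_plane k q e)"
      using Z big_half_plane_eq by (auto simp: subset_iff not_le)
    then show False using empty by blast
  qed
  have "octahedral k (all_edges n - Z)"
  proof (rule octahedral_complement[OF Z])
    fix u show "\<not> Z \<subseteq> across u" using none[of "Q u"] h_across_pos[of _ u] by force
  next
    fix e f assume ef: "e \<in> Z" "f \<in> Z" "e \<noteq> f"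
    show "e \<inter> f = {}"
    proof (rule ccontr)
      assume "e \<inter> f \<noteq> {}"
      then obtain a where a: "e = star a \<and> f = star (a + k + 1) \<or> f = star a \<and> e = star (a + k + 1)"
        using adjacent_stars ef Z by (metis subsetD)
      have "card (Z - {e, f}) = 1" using ef Z by (subst card_Diff_subset) auto
      then obtain g where g: "Z - {e, f} = {g}" by (auto simp: card_1_singleton_iff)
      then have "g \<in> rel" "g \<noteq> star a" "g \<noteq> star (a + k + 1)" using Z a by blast+
      then obtain z where "h (star a) (z, 1) > 0" "h (star (a + k + 1)) (z, 1) > 0" "h g (z, 1) > 0"
        using adjacent_triple_meets by blast
      moreover have "Z = {star a, star (a + k + 1), g}" using g ef a by blast
      ultimately show False using none[of z] by force
    qed
  qed
  moreover have "all_edges n - (all_edges n - Z) = Z" using Z rel_subset_all by blast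
  ultimately show False using oct[of "all_edges n - Z"] empty by simp
qed

lemma octahedral_iff_all_meet:
  "(\<forall>T. octahedral k T \<longrightarrow> (\<Inter>e\<in>all_edges n - T. big_half_plane k q e) \<noteq> {}) \<longleftrightarrow>
   (\<Inter>e\<in>rel. big_half_plane k q e) \<noteq> {}"
proof
  assume oct: "\<forall>T. octahedral k T \<longrightarrow> (\<Inter>e\<in>all_edges n - T. big_half_plane k q e) \<noteq> {}"
  have "card rel = n" using relevant_window[of 0] star_inj_on[of 0] by (simp add: card_image)
  then have c: "card (big_half_plane k q ` rel) = n" using inj_on_big_half_plane by (simp add: card_image)
  show "(\<Inter>e\<in>rel. big_half_plane k q e) \<noteq> {}"
  proof (rule Helly)
    show "DIM(real \<times> real) + 1 \<le> card (big_half_plane k q ` rel)" using c n_ge by simp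
    show "\<forall>s\<in>big_half_plane k q ` rel. convex s" using convex_big_half_plane by blast
    fix t assume t: "t \<subseteq> big_half_plane k q ` rel" "card t = DIM(real \<times> real) + 1"
    then obtain Z where Z: "Z \<subseteq> rel" "t = big_half_plane k q ` Z" by (meson subset_image_iff)
    then have "card Z = 3"
      using t(2) inj_on_subset[OF inj_on_big_half_plane Z(1)] by (simp add: card_image)
    then show "\<Inter> t \<noteq> {}" using triple_meets oct Z by blast
  qed
next
  assume "(\<Inter>e\<in>rel. big_half_plane k q e) \<noteq> {}"
  moreover have "all_edges n - T \<subseteq> rel" if "octahedral k T" for T
    using that k_triangulation_complement n_def by (auto simp: octahedral_def)
  ultimately show "\<forall>T. octahedral k T \<longrightarrow> (\<Inter>e\<in>all_edges n - T. big_half_plane k q e) \<noteq> {}"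
    by blast
qed

end

section \<open>Linear dependences modulo the short edges\<close>

lemma lookup_scaleR: "Poly_Mapping.lookup (r *\<^sub>R x) i = r *\<^sub>R Poly_Mapping.lookup x i"
proof -
  have "finite {i. r *\<^sub>R Poly_Mapping.lookup x i \<noteq> 0}"
    by (rule finite_subset[OF _ finite_lookup[of x]]) auto
  then show ?thesis by (simp add: scaleR_poly_mapping_def Abs_poly_mapping_inverse)
qed

lemma span_image_finite:
  fixes v :: "'e \<Rightarrow> 'v::real_vector"
  assumes "finite A"
  shows "span (v ` A) = {\<Sum>e\<in>A. c e *\<^sub>R v e | c. True}" (is "_ = ?S")
proof
  show "span (v ` A) \<subseteq> ?S"
  proof (rule span_minimal)
    show "v ` A \<subseteq> ?S"
    proof
      fix x assume "x \<in> v ` A"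
      then obtain a where a: "a \<in> A" "x = v a" by auto
      have "(\<Sum>e\<in>A. (if e = a then 1 else 0) *\<^sub>R v e) = (\<Sum>e\<in>A. if e = a then v e else 0)"
        by (rule sum.cong) auto
      then have "(\<Sum>e\<in>A. (if e = a then 1 else 0) *\<^sub>R v e) = x"
        using a assms by simp
      then show "x \<in> ?S" by (intro CollectI exI[of _ "\<lambda>e. if e = a then 1 else 0"]) simp
    qed
    show "subspace ?S"
    proof (rule subspaceI)
      show "0 \<in> ?S" by (intro CollectI exI[of _ "\<lambda>_. 0"]) simp
    next
      fix x y assume "x \<in> ?S" "y \<in> ?S"
      then obtain c d where "x = (\<Sum>e\<in>A. c e *\<^sub>R v e)" "y = (\<Sum>e\<in>A. d e *\<^sub>R v e)" by auto
      then show "x + y \<in> ?S"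
        by (intro CollectI exI[of _ "\<lambda>e. c e + d e"]) (simp add: scaleR_add_left sum.distrib)
    next
      fix r x assume "x \<in> ?S"
      then obtain c where "x = (\<Sum>e\<in>A. c e *\<^sub>R v e)" by auto
      then show "r *\<^sub>R x \<in> ?S"
        by (intro CollectI exI[of _ "\<lambda>e. r * c e"]) (simp add: scaleR_sum_right)
    qed
  qed
  show "?S \<subseteq> span (v ` A)"
  proof clarify
    fix c show "(\<Sum>e\<in>A. c e *\<^sub>R v e) \<in> span (v ` A)"
      by (intro span_sum span_scale span_base imageI)
  qed
qed

lemma coset_eq_iff:
  assumes "subspace L" shows "coset L x = coset L y \<longleftrightarrow> x - y \<in> L"
proof
  assume "coset L x = coset L y"
  then have "x + 0 \<in> coset L y" using subspace_0[OF assms] unfolding coset_def by blast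
  then show "x - y \<in> L" by (auto simp: coset_def)
next
  assume xy: "x - y \<in> L"
  have "coset L a \<subseteq> coset L b" if "a - b \<in> L" for a b
  proof
    fix z assume "z \<in> coset L a"
    then obtain l where "l \<in> L" "z = a + l" by (auto simp: coset_def)
    then have "z = b + ((a - b) + l)" "(a - b) + l \<in> L" using that subspace_add[OF assms] by auto
    then show "z \<in> coset L b" unfolding coset_def by blast
  qed
  moreover have "y - x \<in> L" using subspace_neg[OF assms xy] by simp
  ultimately show "coset L x = coset L y" using xy by blast
qed

lemma c_vec_swap:
  assumes "m < 2 * k" shows "c_vec (2 * k) b a m = - c_vec (2 * k) a b m"
proof -
  have "c_vec (2 * k) b a m = (- 1) ^ m * (- 1) ^ (2 * k - 1 - m) * c_vec (2 * k) a b m"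
    using power_minus[of "snd a - snd b" m] power_minus[of "fst a - fst b" "2 * k - 1 - m"]
    unfolding c_vec_def by simp
  also have "(- 1) ^ m * (- 1) ^ (2 * k - 1 - m) = (- 1 :: real) ^ (2 * k - 1)"
    unfolding power_add[symmetric] using assms by simp
  also have "\<dots> = - 1"
  proof -
    have "odd (2 * k - 1)" using assms by auto
    then show ?thesis by simp
  qed
  finally show ?thesis by simp
qed

lemma all_edges_eq: "all_edges n = {{i, j} | i j. i \<in> {1..n} \<and> j \<in> {1..n} \<and> i < j}"
proof (intro equalityI subsetI)
  fix e assume "e \<in> all_edges n"
  then have "e \<subseteq> {1..n}" "card e = 2" by (auto simp: all_edges_def)
  then obtain i j where "e = {i, j}" "i < j" by (metis card_2_iff insert_commute linorder_neqE_nat)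
  then show "e \<in> {{i, j} | i j. i \<in> {1..n} \<and> j \<in> {1..n} \<and> i < j}" using \<open>e \<subseteq> {1..n}\<close> by blast
qed (auto simp: all_edges_def)

lemma finite_all_edges: "finite (all_edges n)"
  by (rule finite_subset[of _ "Pow {1..n}"]) (auto simp: all_edges_def)

lemma lookup_C_row_general:
  assumes "i \<noteq> j" "m < 2 * k"
  shows "Poly_Mapping.lookup (C_row (2 * k) q {i, j}) (i, m) = c_vec (2 * k) (q i) (q j) m"
proof (cases "i < j")
  case False
  then have "j < i" using assms by simp
  then show ?thesis
    using lookup_C_row[of j i "2 * k" q i m] assms c_vec_swap[of m k "q i" "q j"]
    by (simp add: insert_commute)
qed (use lookup_C_row[of i j "2 * k" q i m] assms in simp)

text \<open>
  The entry of \<open>{i, j}\<close> in the block of \<open>i\<close> is \<open>c_vec (2 * k) (q i) (q j)\<close> whether or not \<open>i < j\<close>,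
  because \<open>c_vec\<close> is homogeneous of the odd degree \<open>2 * k - 1\<close>.
\<close>

lemma C_row_dependence_iff:
  "(\<Sum>e\<in>all_edges n. c e *\<^sub>R C_row (2 * k) q e) = 0 \<longleftrightarrow>
   (\<forall>i\<in>{1..n}. \<forall>m<2*k. (\<Sum>j\<in>{1..n} - {i}. c {i, j} * c_vec (2 * k) (q i) (q j) m) = 0)"
proof -
  let ?x = "\<Sum>e\<in>all_edges n. c e *\<^sub>R C_row (2 * k) q e"
  let ?lk = Poly_Mapping.lookup
  have lk: "?lk ?x (i, m) = (\<Sum>e\<in>all_edges n. c e * ?lk (C_row (2 * k) q e) (i, m))" for i m
    by (simp add: lookup_sum lookup_scaleR)
  have out: "?lk (C_row (2 * k) q e) (i, m) = 0" if "e \<in> all_edges n" "i \<notin> e \<or> \<not> m < 2 * k" for e i m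
    using that by (auto simp: all_edges_eq lookup_C_row split: if_splits)
  have col: "?lk ?x (i, m) = (\<Sum>j\<in>{1..n} - {i}. c {i, j} * c_vec (2 * k) (q i) (q j) m)"
    if i: "i \<in> {1..n}" and m: "m < 2 * k" for i m
  proof -
    have inj: "inj_on (\<lambda>j. {i, j}) ({1..n} - {i})" by (auto simp: inj_on_def doubleton_eq_iff)
    have "?lk ?x (i, m) = (\<Sum>e\<in>(\<lambda>j. {i, j}) ` ({1..n} - {i}). c e * ?lk (C_row (2 * k) q e) (i, m))"
      unfolding lk
    proof (rule sum.mono_neutral_right)
      show "(\<lambda>j. {i, j}) ` ({1..n} - {i}) \<subseteq> all_edges n" using i by (auto simp: all_edges_def)
      show "\<forall>e\<in>all_edges n - (\<lambda>j. {i, j}) ` ({1..n} - {i}). c e * ?lk (C_row (2 * k) q e) (i, m) = 0"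
      proof
        fix e assume e: "e \<in> all_edges n - (\<lambda>j. {i, j}) ` ({1..n} - {i})"
        then obtain a b where ab: "e = {a, b}" "a \<in> {1..n}" "b \<in> {1..n}" "a < b"
          by (auto simp: all_edges_eq)
        have "i \<notin> e"
        proof
          assume "i \<in> e"
          then have "e = {i, a} \<and> a \<noteq> i \<or> e = {i, b} \<and> b \<noteq> i" using ab by auto
          then show False using e ab by blast
        qed
        then show "c e * ?lk (C_row (2 * k) q e) (i, m) = 0" using out e by simp
      qed
    qed (rule finite_all_edges)
    also have "\<dots> = (\<Sum>j\<in>{1..n} - {i}. c {i, j} * ?lk (C_row (2 * k) q {i, j}) (i, m))"
      using inj by (simp add: sum.reindex)
    also have "\<dots> = (\<Sum>j\<in>{1..n} - {i}. c {i, j} * c_vec (2 * k) (q i) (q j) m)"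
      using m by (intro sum.cong) (auto simp: lookup_C_row_general)
    finally show ?thesis .
  qed
  have zero: "?lk ?x (i, m) = 0" if "i \<notin> {1..n} \<or> \<not> m < 2 * k" for i m
    unfolding lk
  proof (intro sum.neutral ballI)
    fix e assume e: "e \<in> all_edges n"
    have "i \<notin> e \<or> \<not> m < 2 * k" using that e by (auto simp: all_edges_def)
    then show "c e * ?lk (C_row (2 * k) q e) (i, m) = 0" using out[OF e] by simp
  qed
  show ?thesis
  proof
    assume "?x = 0"
    then have "?lk ?x (i, m) = 0" for i m by simp
    then show "\<forall>i\<in>{1..n}. \<forall>m<2*k. (\<Sum>j\<in>{1..n} - {i}. c {i, j} * c_vec (2 * k) (q i) (q j) m) = 0"
      using col by simp
  next
    assume R: "\<forall>i\<in>{1..n}. \<forall>m<2*k. (\<Sum>j\<in>{1..n} - {i}. c {i, j} * c_vec (2 * k) (q i) (q j) m) = 0"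
    show "?x = 0"
    proof (rule poly_mapping_eqI)
      fix im :: "nat \<times> nat"
      obtain i m where "im = (i, m)" by (cases im)
      then show "?lk ?x im = ?lk 0 im" using R col zero by (cases "i \<in> {1..n} \<and> m < 2 * k") auto
    qed
  qed
qed

context star_polygon begin

lemma general_position:
  assumes "i \<in> {1..n}" "j \<in> {1..n}" "l \<in> {1..n}" "i \<noteq> j" "j \<noteq> l" "i \<noteq> l"
  shows "orient (q i) (q j) (q l) \<noteq> 0"
proof -
  have sorted: "orient (q i) (q j) (q l) \<noteq> 0" if "1 \<le> i" "i < j" "j < l" "l \<le> n" for i j l
    using oriented[OF that] by auto
  have rot: "orient (q i) (q j) (q l) = orient (q j) (q l) (q i)" for i j l by (simp add: orient_rotate)
  have sw: "orient (q i) (q j) (q l) = - orient (q j) (q i) (q l)" for i j l by (rule orient_swap)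
  consider "i < j" "j < l" | "i < l" "l < j" | "j < i" "i < l" | "j < l" "l < i" | "l < i" "i < j" | "l < j" "j < i"
    using assms by linarith
  then show ?thesis
    by cases (use assms sorted[of i j l] sorted[of i l j] sorted[of j i l] sorted[of j l i]
      sorted[of l i j] sorted[of l j i] rot[of i j l] rot[of l i j] sw[of i j l] rot[of j i l] rot[of l j i] in auto)
qed

definition den :: "nat set \<Rightarrow> real" where
  "den e = (\<Prod>l\<in>{1..n} - {Min e} - {Max e}. orient (q (Min e)) (q (Max e)) (q l))"

lemma den_nonzero: assumes "e \<in> all_edges n" shows "den e \<noteq> 0"
proof -
  obtain i j where "e = {i, j}" "i \<in> {1..n}" "j \<in> {1..n}" "i < j" using assms by (auto simp: all_edges_eq)
  then show ?thesis using general_position by (auto simp: den_def)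
qed

lemma edge_dependence_iff:
  "(\<Sum>e\<in>all_edges n. c e *\<^sub>R C_row (2 * k) q e) = 0 \<longleftrightarrow>
   (\<exists>p. \<forall>e\<in>all_edges n. c e = hdet (q (Min e)) (q (Max e)) p / den e)"
proof -
  let ?B = "\<lambda>i j. \<Prod>l\<in>{1..n} - {i} - {j}. orient (q i) (q j) (q l)"
  have card: "card {1..n} = 2 * k + 3" by (simp add: n_def)
  have "(\<Sum>e\<in>all_edges n. c e *\<^sub>R C_row (2 * k) q e) = 0 \<longleftrightarrow>
    (\<exists>p. \<forall>i\<in>{1..n}. \<forall>j\<in>{1..n} - {i}. c {i, j} = hdet (q i) (q j) p / ?B i j)"
    unfolding C_row_dependence_iff
    by (rule symmetric_stress_iff) (use card general_position in \<open>auto simp: insert_commute\<close>)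
  also have "\<dots> \<longleftrightarrow> (\<exists>p. \<forall>e\<in>all_edges n. c e = hdet (q (Min e)) (q (Max e)) p / den e)"
  proof (intro iff_exI iffI ballI)
    fix p e assume p: "\<forall>i\<in>{1..n}. \<forall>j\<in>{1..n} - {i}. c {i, j} = hdet (q i) (q j) p / ?B i j"
      and "e \<in> all_edges n"
    then obtain i j where e: "e = {i, j}" "i \<in> {1..n}" "j \<in> {1..n}" "i < j" by (auto simp: all_edges_eq)
    then have "Min e = i" "Max e = j" by auto
    then show "c e = hdet (q (Min e)) (q (Max e)) p / den e" using p e by (simp add: den_def)
  next
    fix p i j assume p: "\<forall>e\<in>all_edges n. c e = hdet (q (Min e)) (q (Max e)) p / den e"
      and ij: "i \<in> {1..n}" "j \<in> {1..n} - {i}"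
    have less: "c {i, j} = hdet (q i) (q j) p / ?B i j" if "i \<in> {1..n}" "j \<in> {1..n}" "i < j" for i j
    proof -
      have "{i, j} \<in> all_edges n" using that unfolding all_edges_eq by blast
      moreover have "Min {i, j} = i" "Max {i, j} = j" using that by auto
      ultimately show ?thesis using p by (simp add: den_def)
    qed
    show "c {i, j} = hdet (q i) (q j) p / ?B i j"
    proof (cases "i < j")
      case False
      then have "c {j, i} = hdet (q j) (q i) p / ?B j i" using less ij by simp
      then show ?thesis
        using prod_orient_swap[OF _ card, of i j q] ij hdet_swap[of "q j" "q i"]
        by (simp add: insert_commute)
    qed (use less ij in simp)
  qed
  finally show ?thesis .
qed

text \<open>
  The factors with \<open>l\<close> between the endpoints have the opposite sign to the others, and there are
  \<open>k\<close> or \<open>k + 1\<close> of them. The second case is the one in which \<open>h\<close> reverses the edge, so the sign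
  of the stress relative to \<open>h\<close> is the same for all relevant edges.
\<close>

lemma den_sign:
  assumes "e \<in> rel"
  shows "(- 1) ^ k * s * (if Max e - Min e = k + 1 then 1 else -1) * den e > 0"
proof -
  have "e \<in> all_edges n" using assms rel_subset_all by blast
  then obtain i j where e: "e = {i, j}" "i \<in> {1..n}" "j \<in> {1..n}" "i < j" by (auto simp: all_edges_eq)
  then have m: "Min e = i" "Max e = j" by auto
  have ji: "j - i = k + 1 \<or> j - i = k + 2"
    using assms e m nk by (auto simp: relevant_edges_def edge_length_def)
  let ?A = "{1..n} - {i} - {j}"
  let ?In = "{i<..<j}" and ?f = "\<lambda>l. s * orient (q i) (q j) (q l)"
  have split: "(\<Prod>l\<in>?A. ?f l) = (\<Prod>l\<in>?In. ?f l) * (\<Prod>l\<in>?A - ?In. ?f l)"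
    by (rule prod.subset_diff[THEN trans]) (use e in \<open>auto simp: mult.commute\<close>)
  have outer: "(\<Prod>l\<in>?A - ?In. ?f l) > 0"
  proof (rule prod_pos)
    fix l assume "l \<in> ?A - ?In"
    then have "l \<in> {1..n}" "l < i \<or> j < l" by auto
    then show "?f l > 0" using oriented[of i j l] oriented[of l i j] e
      by (auto simp: orient_rotate[of "q i" "q j" "q l"])
  qed
  have inner: "(- 1) ^ (j - i - 1) * (\<Prod>l\<in>?In. ?f l) > 0"
  proof -
    have "(\<Prod>l\<in>?In. - ?f l) > 0"
    proof (rule prod_pos)
      fix l assume "l \<in> ?In"
      then have "s * orient (q i) (q l) (q j) > 0" using oriented[of i l j] e by auto
      moreover have "orient (q i) (q j) (q l) = - orient (q i) (q l) (q j)"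
        by (simp add: orient_def cross2_def algebra_simps)
      ultimately show "- ?f l > 0" by simp
    qed
    then show ?thesis by (simp only: prod_uminus card_greaterThanLessThan) simp
  qed
  have pos: "(- 1) ^ (j - i - 1) * (\<Prod>l\<in>?A. ?f l) > 0"
    unfolding split mult.assoc[symmetric] by (rule mult_pos_pos[OF inner outer])
  have "card ?A = 2 * k + 1" using e nk by auto
  then have total: "(\<Prod>l\<in>?A. ?f l) = s ^ (2 * k + 1) * den e"
    by (simp add: prod.distrib den_def m)
  have sp: "s ^ (2 * k + 1) = s" using s_square by (simp add: power_mult power2_eq_square)
  have "(- 1) ^ (j - i - 1) * (s * den e) > 0" using pos unfolding total sp .
  moreover have "(- 1 :: real) ^ (j - i - 1) = (- 1) ^ k * (if j - i = k + 1 then 1 else -1)"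
    using ji
  proof
    assume a: "j - i = k + 1"
    then have "j - i - 1 = k" by simp
    then show ?thesis unfolding \<open>j - i - 1 = k\<close> using a by simp
  next
    assume a: "j - i = k + 2"
    then have "j - i - 1 = k + 1" by simp
    then show ?thesis unfolding \<open>j - i - 1 = k + 1\<close> using a by simp
  qed
  ultimately show ?thesis unfolding m by (simp add: mult_ac)
qed

lemma h_over_den:
  assumes "e \<in> rel"
  shows "hdet (q (Min e)) (q (Max e)) ((- 1) ^ k *\<^sub>R p) / den e = h e p / \<bar>den e\<bar>"
proof -
  define t where "t = s * (if Max e - Min e = k + 1 then 1 else - 1 :: real)"
  have tt: "t * t = 1" using s_square by (auto simp: t_def)
  define r where "r = (- 1 :: real) ^ k"
  have rr: "r * r = 1" by (simp add: r_def flip: power_mult_distrib)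
  have pos: "r * t * den e > 0" using den_sign[OF assms] by (simp add: r_def t_def mult_ac)
  have "\<bar>r\<bar> = 1" "\<bar>t\<bar> = 1"
    using rr tt abs_square_eq_1[of r] abs_square_eq_1[of t] by (simp_all add: power2_eq_square)
  then have "\<bar>den e\<bar> = \<bar>r * t * den e\<bar>" by (simp add: abs_mult)
  then have abs: "\<bar>den e\<bar> = r * t * den e" using pos by simp
  have "h e p = t * hdet (q (Min e)) (q (Max e)) p" by (simp add: h_def t_def)
  moreover have "r * x / d = t * x / (r * t * d)" if "d \<noteq> 0" for x d
  proof -
    have "r \<noteq> 0" "t \<noteq> 0" using rr tt by auto
    then show ?thesis using that rr by (simp add: field_simps)
  qed
  moreover have "den e \<noteq> 0" using pos by auto
  ultimately show ?thesis unfolding abs hdet_linear_simps r_def[symmetric] by simp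
qed

abbreviation v :: "nat set \<Rightarrow> (nat \<times> nat) \<Rightarrow>\<^sub>0 real" where "v \<equiv> C_row (2 * k) q"
abbreviation L :: "((nat \<times> nat) \<Rightarrow>\<^sub>0 real) set" where "L \<equiv> span (v ` short_edges k n)"
abbreviation W :: "((nat \<times> nat) \<Rightarrow>\<^sub>0 real) set" where "W \<equiv> span (v ` all_edges n)"

lemma rel_short: "all_edges n = rel \<union> short_edges k n" "rel \<inter> short_edges k n = {}"
    "finite (short_edges k n)"
proof -
  show "all_edges n = rel \<union> short_edges k n" "rel \<inter> short_edges k n = {}"
    by (auto simp: relevant_edges_def short_edges_def)
  then show "finite (short_edges k n)" using finite_all_edges[of n] by (metis finite_Un)
qed

lemma sum_all_edges:
  "(\<Sum>e\<in>all_edges n. f e) = (\<Sum>e\<in>rel. f e) + (\<Sum>e\<in>short_edges k n. (f e :: (nat \<times> nat) \<Rightarrow>\<^sub>0 real))"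
  unfolding rel_short(1) by (rule sum.union_disjoint) (use finite_rel rel_short in auto)

text \<open>
  The coefficients of the short rows are free, so a self-stress restricts the relevant
  coefficients only through \<open>p\<close>. The global sign \<open>(- 1) ^ k\<close> is absorbed into \<open>p\<close>.
\<close>

lemma relevant_dependence_iff:
  "(\<Sum>e\<in>rel. c e *\<^sub>R v e) \<in> L \<longleftrightarrow> (\<exists>p. \<forall>e\<in>rel. c e = h e p / \<bar>den e\<bar>)"
proof
  assume "(\<Sum>e\<in>rel. c e *\<^sub>R v e) \<in> L"
  then obtain c' where c': "(\<Sum>e\<in>rel. c e *\<^sub>R v e) = (\<Sum>e\<in>short_edges k n. c' e *\<^sub>R v e)"
    unfolding span_image_finite[OF rel_short(3)] by auto
  define C where "C e = (if e \<in> rel then c e else - c' e)" for e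
  have "(\<Sum>e\<in>short_edges k n. C e *\<^sub>R v e) = (\<Sum>e\<in>short_edges k n. - (c' e *\<^sub>R v e))"
    by (rule sum.cong) (use rel_short(2) in \<open>auto simp: C_def\<close>)
  then have "(\<Sum>e\<in>all_edges n. C e *\<^sub>R v e) = 0"
    unfolding sum_all_edges using c' by (simp add: C_def sum_negf)
  then obtain p where p: "\<forall>e\<in>all_edges n. C e = hdet (q (Min e)) (q (Max e)) p / den e"
    using edge_dependence_iff by blast
  have pp: "(- 1) ^ k *\<^sub>R (- 1) ^ k *\<^sub>R p = p" by (simp flip: power_mult_distrib)
  have "c e = h e ((- 1) ^ k *\<^sub>R p) / \<bar>den e\<bar>" if e: "e \<in> rel" for e
  proof -
    have "c e = C e" using e by (simp add: C_def)
    also have "\<dots> = hdet (q (Min e)) (q (Max e)) p / den e" using p e rel_subset_all by blast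
    finally show ?thesis using h_over_den[OF e, of "(- 1) ^ k *\<^sub>R p"] unfolding pp by simp
  qed
  then show "\<exists>p. \<forall>e\<in>rel. c e = h e p / \<bar>den e\<bar>" by blast
next
  assume "\<exists>p. \<forall>e\<in>rel. c e = h e p / \<bar>den e\<bar>"
  then obtain p where p: "\<forall>e\<in>rel. c e = h e p / \<bar>den e\<bar>" by blast
  define C where "C e = hdet (q (Min e)) (q (Max e)) ((- 1) ^ k *\<^sub>R p) / den e" for e
  have "(\<Sum>e\<in>all_edges n. C e *\<^sub>R v e) = 0" using edge_dependence_iff C_def by blast
  then have "(\<Sum>e\<in>rel. C e *\<^sub>R v e) = (\<Sum>e\<in>short_edges k n. (- C e) *\<^sub>R v e)"
    unfolding sum_all_edges by (simp add: sum_negf eq_neg_iff_add_eq_0)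
  moreover have "(\<Sum>e\<in>rel. C e *\<^sub>R v e) = (\<Sum>e\<in>rel. c e *\<^sub>R v e)"
    by (rule sum.cong) (use p h_over_den in \<open>auto simp: C_def\<close>)
  moreover have "(\<Sum>e\<in>short_edges k n. (- C e) *\<^sub>R v e) \<in> L"
    by (intro span_sum span_scale span_base) auto
  ultimately show "(\<Sum>e\<in>rel. c e *\<^sub>R v e) \<in> L" by simp
qed

end

section \<open>The fan of cones\<close>

context star_polygon begin

lemma h_not_across:
  assumes "e \<in> rel" "e \<notin> across u" shows "h e (Q u, 1) \<le> 0"
proof -
  obtain b where b: "b \<in> {u + 1..<u + 1 + n}" "e = star b" using assms(1) relevant_window[of "u + 1"] by blast
  have "b \<notin> {u + 1..u + k + 1}" using assms(2) b by (auto simp: across_def)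
  then consider "b = u + n" | "u + n = b + k + 1" | "b < u + n" "u + n < b + k + 1"
    using b nk by fastforce
  then have "h (star b) (Q (u + n), 1) \<le> 0"
  proof cases
    case 1 then show ?thesis using h_endpoints(1)[of b] by simp
  next
    case 2 then show ?thesis using h_endpoints(2)[of b] by simp
  next
    case 3
    then have "h (star b) (Q (u + n), 1) < 0" by (rule h_vertex_neg)
    then show ?thesis by simp
  qed
  then show ?thesis using b by simp
qed

text \<open>
  If \<open>snd p \<le> 0\<close>, adding a multiple of a vertex \<open>Q 0\<close> gives a direction along which the \<open>k + 3\<close>
  consecutive forms \<open>star 0, \<dots>, star (k + 2)\<close> increase. The reversed direction increases
  \<open>k + 1\<close> consecutive forms, but only \<open>k\<close> are left.
\<close>

lemma positive_imp_affine:
  assumes pos: "\<And>e. e \<in> rel \<Longrightarrow> h e p > 0" shows "snd p > 0"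
proof (rule ccontr)
  assume "\<not> snd p > 0"
  define z where "z = p - snd p *\<^sub>R (Q 0, 1)"
  have hz: "h e z = h e p - snd p * h e (Q 0, 1)" for e unfolding z_def by (simp only: h_linear_simps)
  have z: "z = (fst z, 0)" by (simp add: z_def prod_eq_iff)
  have zpos: "h (star b) z > 0" if "b \<le> k + 2" for b
  proof -
    have "h (star b) (Q 0, 1) \<ge> 0"
    proof -
      have "b = 0 \<or> b = k + 2 \<or> b \<in> {0 + 1..0 + k + 1}" using that by auto
      then consider "b = 0" | "b = k + 2" | "star b \<in> across 0"
        unfolding across_def by blast
      then show ?thesis
      proof cases
        case 1 then show ?thesis using h_endpoints(1)[of b] by simp
      next
        case 2
        then have "b + k + 1 = 0 + n" using nk by simp
        moreover have "vert (0 + n) = vert 0" by (rule vert_periodic)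
        ultimately have "h (star b) (Q 0, 1) = 0" using h_endpoints(2)[of b] by metis
        then show ?thesis by simp
      next
        case 3 then show ?thesis using h_across_pos by (simp add: less_imp_le)
      qed
    qed
    then have "snd p * h (star b) (Q 0, 1) \<le> 0"
      using \<open>\<not> snd p > 0\<close> by (simp add: mult_nonpos_nonneg)
    then show ?thesis using pos[OF star_relevant[of b]] by (simp add: hz)
  qed
  have "fst z \<noteq> 0"
  proof
    assume "fst z = 0"
    then have "z = 0" using z by (simp add: prod_eq_iff)
    then show False using zpos[of 0] by (simp add: h_linear_simps)
  qed
  then obtain u where "\<forall>e\<in>across u. h e (- fst z, 0) > 0"
    using direction_sees_across[of "- fst z"] by auto
  moreover have "(- fst z, 0) = - z" using z by (simp add: prod_eq_iff)
  ultimately have neg: "h e z < 0" if "e \<in> across u" for e using that by (auto simp: h_linear_simps)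
  define w where "w = u mod n"
  have w: "w < n" "across w = across u" using n_ge across_mod by (simp_all add: w_def)
  have "\<exists>b\<le>k + 2. star b \<in> across w"
  proof (cases "w \<le> k + 1")
    case True
    then show ?thesis by (intro exI[of _ "w + 1"]) (auto simp: across_def)
  next
    case False
    then have "n \<in> {w + 1..w + k + 1}" using w nk by auto
    then have "star n \<in> across w" by (auto simp: across_def)
    then show ?thesis using star_periodic(1)[of 0] by (intro exI[of _ 0]) simp
  qed
  then show False using neg zpos w(2) by (metis less_asym)
qed

text \<open>
  The function \<open>\<Phi>\<close> is positively homogeneous and, by \<open>recession\<close>, positive away from the origin; on
  the given set it is bounded.
\<close>

lemma bounded_sublevel:
  assumes P0: "\<And>e. e \<in> rel \<Longrightarrow> h e (P0, 1) > 0"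
  shows "bounded {p. (\<forall>e\<in>rel. c e + h e p \<ge> 0) \<and> snd p \<le> r}"
proof -
  define \<Phi> where "\<Phi> p = (\<Sum>e\<in>rel. max 0 (- h e p)) + max 0 (snd p)" for p :: "(real \<times> real) \<times> real"
  have cont: "continuous_on S \<Phi>" for S
    unfolding \<Phi>_def by (intro continuous_intros continuous_on_h)
  have nn: "(\<Sum>e\<in>rel. max 0 (- h e p)) \<ge> 0" for p by (intro sum_nonneg) simp
  have pos: "\<Phi> x > 0" if "x \<noteq> 0" for x
  proof (rule ccontr)
    assume "\<not> \<Phi> x > 0"
    then have "(\<Sum>e\<in>rel. max 0 (- h e x)) = 0" "max 0 (snd x) = 0"
      using nn[of x] unfolding \<Phi>_def by linarith+
    then have "\<forall>e\<in>rel. max 0 (- h e x) = 0"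
      using sum_nonneg_eq_0_iff[OF finite_rel, of "\<lambda>e. max 0 (- h e x)"] by simp
    then have "h e x \<ge> 0" if "e \<in> rel" for e using that by (auto simp: max_def split: if_splits)
    moreover have "across u \<inter> rel \<noteq> {}" for u
    proof -
      have "across u \<noteq> {}" using card_across[of u] by auto
      then show ?thesis using across_subset[of u] by blast
    qed
    moreover have "snd x \<le> 0" using \<open>max 0 (snd x) = 0\<close> by (simp add: max_def split: if_splits)
    ultimately have "x = 0" using recession[of P0 rel x] P0 by auto
    then show False using that by simp
  qed
  have "sphere 0 1 \<noteq> ({} :: ((real \<times> real) \<times> real) set)"
  proof -
    have "(0, 1) \<in> sphere (0 :: (real \<times> real) \<times> real) 1" by (simp add: norm_Pair)
    then show ?thesis by blast
  qed
  then obtain x0 where x0: "x0 \<in> sphere 0 1" "\<forall>y\<in>sphere 0 1. \<Phi> x0 \<le> \<Phi> y"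
    using continuous_attains_inf[OF compact_sphere _ cont] by metis
  define m where "m = \<Phi> x0"
  have "x0 \<noteq> 0" using x0(1) by auto
  then have m: "m > 0" using pos by (simp add: m_def)
  have scale: "\<Phi> (t *\<^sub>R p) = t * \<Phi> p" if "t \<ge> 0" for t p
  proof -
    have mx: "max 0 (t * y) = t * max 0 y" for y :: real
      using that by (auto simp: max_def mult_le_0_iff zero_le_mult_iff)
    have "max 0 (- h e (t *\<^sub>R p)) = t * max 0 (- h e p)" for e
      using mx[of "- h e p"] by (simp add: h_linear_simps)
    then show ?thesis by (simp add: \<Phi>_def mx sum_distrib_left distrib_left)
  qed
  have lower: "norm p * m \<le> \<Phi> p" for p
  proof (cases "p = 0")
    case False
    have "p = norm p *\<^sub>R sgn p" using False by (simp add: sgn_div_norm)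
    then have "\<Phi> p = norm p * \<Phi> (sgn p)" using scale[of "norm p" "sgn p"] by simp
    moreover have "\<Phi> (sgn p) \<ge> m" using x0(2) False by (simp add: m_def norm_sgn)
    ultimately show ?thesis by (simp add: mult_left_mono)
  qed (use nn[of 0] in \<open>simp add: \<Phi>_def\<close>)
  have "norm p \<le> ((\<Sum>e\<in>rel. \<bar>c e\<bar>) + \<bar>r\<bar>) / m" if p: "\<forall>e\<in>rel. c e + h e p \<ge> 0" "snd p \<le> r" for p
  proof -
    have "\<Phi> p \<le> (\<Sum>e\<in>rel. \<bar>c e\<bar>) + \<bar>r\<bar>"
      unfolding \<Phi>_def
    proof (rule add_mono)
      show "(\<Sum>e\<in>rel. max 0 (- h e p)) \<le> (\<Sum>e\<in>rel. \<bar>c e\<bar>)"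
        by (rule sum_mono) (use p in force)
    qed (use p in auto)
    then show ?thesis using lower[of p] m by (simp add: pos_le_divide_eq)
  qed
  then show ?thesis unfolding bounded_iff by blast
qed

text \<open>
  The point is a minimiser of the linear functional \<open>snd\<close> on the polyhedron. If every constraint in
  \<open>across u\<close> had slack, one could subtract a small multiple of \<open>(Q u, 1)\<close>, because all other forms
  are nonpositive at the vertex \<open>Q u\<close>, and this would decrease \<open>snd\<close>.
\<close>

lemma minimiser_exists:
  assumes P0: "\<And>e. e \<in> rel \<Longrightarrow> h e (P0, 1) > 0"
  shows "\<exists>p. (\<forall>e\<in>rel. c e + h e p \<ge> 0) \<and> (\<forall>u. \<exists>e\<in>across u. c e + h e p = 0)"
proof -
  let ?P = "{p. \<forall>e\<in>rel. c e + h e p \<ge> 0}"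
  \<comment> \<open>A large multiple of \<open>(P0, 1)\<close> is feasible.\<close>
  define M where "M = (\<Sum>e\<in>rel. \<bar>c e\<bar> / h e (P0, 1))"
  have start: "M *\<^sub>R (P0, 1) \<in> ?P"
  proof (intro CollectI ballI)
    fix e assume e: "e \<in> rel"
    have "\<bar>c e\<bar> / h e (P0, 1) \<le> M"
      unfolding M_def by (rule member_le_sum) (use e P0 finite_rel in \<open>auto intro!: divide_nonneg_pos\<close>)
    then have "\<bar>c e\<bar> \<le> M * h e (P0, 1)" using P0[OF e] by (simp add: pos_divide_le_eq)
    moreover have "h e (M *\<^sub>R (P0, 1)) = M * h e (P0, 1)" by (rule h_linear_simps)
    ultimately show "c e + h e (M *\<^sub>R (P0, 1)) \<ge> 0" by linarith
  qed
  define K where "K = {p. (\<forall>e\<in>rel. c e + h e p \<ge> 0) \<and> snd p \<le> M}"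
  have "closed K"
  proof -
    have "K = (\<Inter>e\<in>rel. {p. 0 \<le> c e + h e p}) \<inter> {p. snd p \<le> M}" by (auto simp: K_def)
    moreover have "closed {p. 0 \<le> c e + h e p}" for e
      by (intro closed_Collect_le continuous_intros continuous_on_h)
    moreover have "closed {p :: (real \<times> real) \<times> real. snd p \<le> M}"
      by (intro closed_Collect_le continuous_intros)
    ultimately show ?thesis by auto
  qed
  then have "compact K" using bounded_sublevel[OF P0, of c M] unfolding K_def compact_eq_bounded_closed by blast
  moreover have "M *\<^sub>R (P0, 1) \<in> K" using start by (simp add: K_def)
  ultimately obtain p where p: "p \<in> K" "\<forall>y\<in>K. snd p \<le> snd y"
    using continuous_attains_inf[of K snd] continuous_on_snd[OF continuous_on_id] by blast
  have pP: "\<forall>e\<in>rel. c e + h e p \<ge> 0" and pM: "snd p \<le> M" using p by (auto simp: K_def)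
  have "\<exists>e\<in>across u. c e + h e p = 0" for u
  proof (rule ccontr)
    assume "\<not> ?thesis"
    then have slack: "c e + h e p > 0" if "e \<in> across u" for e
      using that pP across_subset[of u] by (metis less_le subsetD)
    let ?r = "\<lambda>e. (c e + h e p) / h e (Q u, 1)"
    define t where "t = Min (?r ` across u)"
    have ne: "across u \<noteq> {}" using card_across[of u] by auto
    then have t: "t > 0"
      using finite_across slack h_across_pos by (auto simp: t_def)
    have step: "c e + h e (p - t *\<^sub>R (Q u, 1)) \<ge> 0" if e: "e \<in> rel" for e
    proof -
      have he: "h e (p - t *\<^sub>R (Q u, 1)) = h e p - t * h e (Q u, 1)" by (simp only: h_linear_simps)
      show ?thesis
      proof (cases "e \<in> across u")
        case True
        then have "t \<le> ?r e" using finite_across by (auto simp: t_def)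
        then have "t * h e (Q u, 1) \<le> c e + h e p" using h_across_pos[OF True] by (simp add: pos_le_divide_eq)
        then show ?thesis unfolding he by simp
      next
        case False
        then have "t * h e (Q u, 1) \<le> 0" using h_not_across[OF e] t by (simp add: mult_le_0_iff)
        then show ?thesis unfolding he using pP e by force
      qed
    qed
    have "p - t *\<^sub>R (Q u, 1) \<in> K" using step pM t by (simp add: K_def)
    then have "snd p \<le> snd (p - t *\<^sub>R (Q u, 1))" using p(2) by blast
    then show False using t by simp
  qed
  then show ?thesis using pP by blast
qed

lemma den_pos: "e \<in> rel \<Longrightarrow> \<bar>den e\<bar> > 0"
  using den_nonzero rel_subset_all by auto

lemma subspace_L: "subspace L" by (rule subspace_span)

lemma sum_extend:
  assumes "F \<subseteq> rel"
  shows "(\<Sum>e\<in>F. c e *\<^sub>R v e) = (\<Sum>e\<in>rel. (if e \<in> F then c e else 0) *\<^sub>R v e)"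
proof -
  have "(\<Sum>e\<in>rel. (if e \<in> F then c e else 0) *\<^sub>R v e) = (\<Sum>e\<in>F. (if e \<in> F then c e else 0) *\<^sub>R v e)"
    by (rule sum.mono_neutral_right) (use assms finite_rel in auto)
  then show ?thesis by (simp cong: sum.cong)
qed

lemma quot_comb_eq_iff:
  assumes "F \<subseteq> rel" "G \<subseteq> rel"
  shows "quot_comb L v c F = quot_comb L v d G \<longleftrightarrow>
    (\<Sum>e\<in>rel. ((if e \<in> F then c e else 0) - (if e \<in> G then d e else 0)) *\<^sub>R v e) \<in> L"
  unfolding quot_comb_def coset_eq_iff[OF subspace_L] sum_extend[OF assms(1)] sum_extend[OF assms(2)]
  by (simp only: scaleR_diff_left sum_subtractf)

lemma W_mod_L:
  assumes "x \<in> W" shows "\<exists>c. x - (\<Sum>e\<in>rel. c e *\<^sub>R v e) \<in> L"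
proof -
  obtain c where "x = (\<Sum>e\<in>all_edges n. c e *\<^sub>R v e)"
    using assms unfolding span_image_finite[OF finite_all_edges] by auto
  then have "x - (\<Sum>e\<in>rel. c e *\<^sub>R v e) = (\<Sum>e\<in>short_edges k n. c e *\<^sub>R v e)"
    by (simp add: sum_all_edges)
  moreover have "\<dots> \<in> L" by (intro span_sum span_scale span_base imageI)
  ultimately show ?thesis by metis
qed

lemma rel_comb_in_W: "F \<subseteq> rel \<Longrightarrow> (\<Sum>e\<in>F. c e *\<^sub>R v e) \<in> W"
  using rel_subset_all by (intro span_sum span_scale span_base imageI) blast

text \<open>
  Two representations differ by some \<open>p\<close>. At \<open>p\<close> the forms are nonnegative where \<open>d\<close> vanishes and
  nonpositive where \<open>c\<close> vanishes, so \<open>recession\<close> applies to \<open>p\<close> or to \<open>- p\<close>, according to the sign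
  of \<open>snd p\<close>.
\<close>

lemma nonneg_representation_unique:
  assumes P0: "\<And>e. e \<in> rel \<Longrightarrow> h e (P0, 1) > 0"
    and c: "\<And>e. e \<in> rel \<Longrightarrow> c e \<ge> 0" "\<And>u. \<exists>e\<in>across u. c e = 0"
    and d: "\<And>e. e \<in> rel \<Longrightarrow> d e \<ge> 0" "\<And>u. \<exists>e\<in>across u. d e = 0"
    and eq: "(\<Sum>e\<in>rel. (c e - d e) *\<^sub>R v e) \<in> L" and "e \<in> rel"
  shows "c e = d e"
proof -
  obtain p where p: "\<forall>e\<in>rel. c e - d e = h e p / \<bar>den e\<bar>"
    using eq unfolding relevant_dependence_iff by blast
  have zero: "x = 0"
    if "snd x \<le> 0" "\<And>u. \<exists>e\<in>across u. b e = 0" "\<And>e. e \<in> rel \<Longrightarrow> b e = 0 \<Longrightarrow> h e x \<ge> 0"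
    for x and b :: "nat set \<Rightarrow> real"
  proof (rule recession[OF P0, of "{e \<in> rel. b e = 0}"])
    show "across u \<inter> {e \<in> rel. b e = 0} \<noteq> {}" for u using that(2)[of u] across_subset[of u] by blast
  qed (use that in auto)
  have sg: "(h e p \<ge> 0 \<longleftrightarrow> c e \<ge> d e) \<and> (h e p \<le> 0 \<longleftrightarrow> c e \<le> d e)" if "e \<in> rel" for e
  proof -
    have "h e p = (c e - d e) * \<bar>den e\<bar>" using p that den_pos[OF that] by simp
    then show ?thesis using den_pos[OF that] by (auto simp: zero_le_mult_iff mult_le_0_iff)
  qed
  have "p = 0"
  proof (cases "snd p \<le> 0")
    case True
    show ?thesis by (rule zero[OF True d(2)]) (use sg c(1) in auto)
  next
    case False
    have "- p = 0" by (rule zero[OF _ c(2)]) (use False sg d(1) in \<open>auto simp: h_linear_simps\<close>)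
    then show ?thesis by simp
  qed
  then show ?thesis using p \<open>e \<in> rel\<close> by (simp add: h_linear_simps)
qed

lemma face_misses:
  assumes "F \<in> reduced_complex k n" shows "\<exists>e\<in>across u. e \<notin> F"
  using assms face_iff by blast

lemma cone_coefficients_unique:
  assumes P0: "\<And>e. e \<in> rel \<Longrightarrow> h e (P0, 1) > 0"
    and FG: "F \<in> reduced_complex k n" "G \<in> reduced_complex k n"
    and "\<forall>e\<in>F. 0 \<le> c e" "\<forall>e\<in>G. 0 \<le> d e"
    and "quot_comb L v c F = quot_comb L v d G" and "e \<in> rel"
  shows "(if e \<in> F then c e else 0) = (if e \<in> G then d e else 0)"
proof (rule nonneg_representation_unique[OF P0])
  have zero: "\<exists>e\<in>across u. (if e \<in> H then b e else 0) = (0 :: real)" if "H \<in> reduced_complex k n" for H u b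
  proof -
    obtain e where "e \<in> across u" "e \<notin> H" using face_misses[OF \<open>H \<in> reduced_complex k n\<close>] by blast
    then show ?thesis by (intro bexI[of _ e]) auto
  qed
  show "\<exists>e\<in>across u. (if e \<in> F then c e else 0) = 0" "\<exists>e\<in>across u. (if e \<in> G then d e else 0) = 0" for u
    by (rule zero[OF FG(1)], rule zero[OF FG(2)])
  have "F \<subseteq> rel" "G \<subseteq> rel" using FG face_iff by blast+
  then show "(\<Sum>e\<in>rel. ((if e \<in> F then c e else 0) - (if e \<in> G then d e else 0)) *\<^sub>R v e) \<in> L"
    using assms quot_comb_eq_iff by blast
qed (use assms in auto)

lemma face_independent:
  assumes P0: "\<And>e. e \<in> rel \<Longrightarrow> h e (P0, 1) > 0" and F: "F \<in> reduced_complex k n"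
  shows "quot_independent L v F"
  unfolding quot_independent_def
proof (intro allI impI ballI)
  fix c e assume c: "quot_comb L v c F = coset L 0" and e: "e \<in> F"
  \<comment> \<open>The positive and the negative part of a dependence represent the same class.\<close>
  define c1 c2 where "c1 e = max 0 (c e)" and "c2 e = max 0 (- c e)" for e
  have c12: "c e = c1 e - c2 e" for e by (simp add: c1_def c2_def max_def)
  have "(\<Sum>e\<in>F. c e *\<^sub>R v e) \<in> L" using c unfolding quot_comb_def coset_eq_iff[OF subspace_L] by simp
  then have "quot_comb L v c1 F = quot_comb L v c2 F"
    unfolding quot_comb_def coset_eq_iff[OF subspace_L] c12 by (simp add: scaleR_diff_left sum_subtractf)
  moreover have "e \<in> rel" using e F face_iff by blast
  ultimately have "c1 e = c2 e"
    using cone_coefficients_unique[OF P0 F F, of c1 c2 e] e by (simp add: c1_def c2_def)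
  then show "c e = 0" using c12 by simp
qed

lemma shift_coefficients:
  assumes "x - (\<Sum>e\<in>rel. c e *\<^sub>R v e) \<in> L"
  shows "x - (\<Sum>e\<in>rel. (c e + h e p / \<bar>den e\<bar>) *\<^sub>R v e) \<in> L"
proof -
  have "(\<Sum>e\<in>rel. (h e p / \<bar>den e\<bar>) *\<^sub>R v e) \<in> L"
    using relevant_dependence_iff[of "\<lambda>e. h e p / \<bar>den e\<bar>"] by blast
  then have "(x - (\<Sum>e\<in>rel. c e *\<^sub>R v e)) - (\<Sum>e\<in>rel. (h e p / \<bar>den e\<bar>) *\<^sub>R v e) \<in> L"
    by (rule subspace_diff[OF subspace_L assms])
  then show ?thesis by (simp only: scaleR_add_left sum.distrib diff_diff_eq)
qed

text \<open>
  The zero set of the representation given by \<open>minimiser_exists\<close> meets every \<open>across u\<close>, so its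
  support is a face.
\<close>

lemma cones_cover:
  assumes P0: "\<And>e. e \<in> rel \<Longrightarrow> h e (P0, 1) > 0" and x: "x \<in> W"
  shows "\<exists>F\<in>reduced_complex k n. coset L x \<in> quot_cone L v F"
proof -
  obtain c where c: "x - (\<Sum>e\<in>rel. c e *\<^sub>R v e) \<in> L" using W_mod_L[OF x] by blast
  obtain p where p: "\<forall>e\<in>rel. c e * \<bar>den e\<bar> + h e p \<ge> 0" "\<forall>u. \<exists>e\<in>across u. c e * \<bar>den e\<bar> + h e p = 0"
    using minimiser_exists[OF P0, of "\<lambda>e. c e * \<bar>den e\<bar>"] by blast
  define d where "d e = c e + h e p / \<bar>den e\<bar>" for e
  have dd: "d e = (c e * \<bar>den e\<bar> + h e p) / \<bar>den e\<bar>" if "e \<in> rel" for e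
    using den_pos[OF that] by (simp add: d_def field_simps)
  have d0: "d e \<ge> 0" if "e \<in> rel" for e using dd[OF that] p(1) that by simp
  have dz: "\<exists>e\<in>across u. d e = 0" for u
  proof -
    obtain e where "e \<in> across u" "c e * \<bar>den e\<bar> + h e p = 0" using p(2) by blast
    then show ?thesis using dd across_subset[of u] by (metis div_0 subsetD)
  qed
  define F where "F = {e \<in> rel. d e \<noteq> 0}"
  have Frel: "F \<subseteq> rel" by (auto simp: F_def)
  have F: "F \<in> reduced_complex k n"
    unfolding face_iff
  proof (intro conjI allI notI)
    fix u assume "across u \<subseteq> F"
    then show False using dz[of u] by (auto simp: F_def)
  qed (rule Frel)
  have dF: "(\<Sum>e\<in>F. d e *\<^sub>R v e) = (\<Sum>e\<in>rel. d e *\<^sub>R v e)"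
    by (rule sum.mono_neutral_left) (use finite_rel in \<open>auto simp: F_def\<close>)
  have "x - (\<Sum>e\<in>F. d e *\<^sub>R v e) \<in> L"
    unfolding dF unfolding d_def by (rule shift_coefficients[OF c])
  then have "coset L x = quot_comb L v d F" unfolding quot_comb_def coset_eq_iff[OF subspace_L] .
  then have "coset L x \<in> quot_cone L v F" unfolding quot_cone_def using d0 Frel by blast
  then show ?thesis using F by blast
qed

lemma fan_if_point:
  assumes P0: "\<And>e. e \<in> rel \<Longrightarrow> h e (P0, 1) > 0"
  shows "complete_simplicial_fan L W v (reduced_complex k n)"
  unfolding complete_simplicial_fan_def
proof (intro conjI ballI)
  show "quot_independent L v F" if "F \<in> reduced_complex k n" for F
    by (rule face_independent[OF P0 that])
  show "quot_cone L v F \<inter> quot_cone L v G = quot_cone L v (F \<inter> G)"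
    if FG: "F \<in> reduced_complex k n" "G \<in> reduced_complex k n" for F G
  proof
    have sub: "F \<subseteq> rel" "G \<subseteq> rel" using FG face_iff by blast+
    show "quot_cone L v F \<inter> quot_cone L v G \<subseteq> quot_cone L v (F \<inter> G)"
    proof
      fix x assume "x \<in> quot_cone L v F \<inter> quot_cone L v G"
      then obtain c d where cd: "\<forall>e\<in>F. 0 \<le> c e" "\<forall>e\<in>G. 0 \<le> d e"
        "x = quot_comb L v c F" "x = quot_comb L v d G" by (auto simp: quot_cone_def)
      have "c e = 0" if "e \<in> F - F \<inter> G" for e
        using cone_coefficients_unique[OF P0 FG cd(1,2), of e] cd that sub by auto
      then have "(\<Sum>e\<in>F \<inter> G. c e *\<^sub>R v e) = (\<Sum>e\<in>F. c e *\<^sub>R v e)"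
        by (intro sum.mono_neutral_left) (use finite_subset[OF sub(1) finite_rel] in auto)
      then have "x = quot_comb L v c (F \<inter> G)" using cd by (simp add: quot_comb_def)
      then show "x \<in> quot_cone L v (F \<inter> G)" using cd(1) unfolding quot_cone_def by blast
    qed
    have mono: "quot_cone L v (F \<inter> G) \<subseteq> quot_cone L v H" if "F \<inter> G \<subseteq> H" "H \<subseteq> rel" for H
    proof
      fix x assume "x \<in> quot_cone L v (F \<inter> G)"
      then obtain c where c: "\<forall>e\<in>F \<inter> G. 0 \<le> c e" "x = quot_comb L v c (F \<inter> G)" by (auto simp: quot_cone_def)
      define c' where "c' e = (if e \<in> F \<inter> G then c e else 0)" for e
      have "(\<Sum>e\<in>H. c' e *\<^sub>R v e) = (\<Sum>e\<in>F \<inter> G. c' e *\<^sub>R v e)"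
        by (rule sum.mono_neutral_right) (use that finite_subset[OF that(2) finite_rel] in \<open>auto simp: c'_def\<close>)
      also have "\<dots> = (\<Sum>e\<in>F \<inter> G. c e *\<^sub>R v e)" by (rule sum.cong) (auto simp: c'_def)
      finally have "x = quot_comb L v c' H" using c by (simp add: quot_comb_def)
      moreover have "\<forall>e\<in>H. 0 \<le> c' e" using c by (simp add: c'_def)
      ultimately show "x \<in> quot_cone L v H" unfolding quot_cone_def by blast
    qed
    show "quot_cone L v (F \<inter> G) \<subseteq> quot_cone L v F \<inter> quot_cone L v G"
      using mono[of F] mono[of G] sub by blast
  qed
  show "(\<Union>F\<in>reduced_complex k n. quot_cone L v F) = quot_space L W"
  proof
    show "(\<Union>F\<in>reduced_complex k n. quot_cone L v F) \<subseteq> quot_space L W"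
    proof
      fix x assume "x \<in> (\<Union>F\<in>reduced_complex k n. quot_cone L v F)"
      then obtain F c where "F \<in> reduced_complex k n" "x = quot_comb L v c F" by (auto simp: quot_cone_def)
      then show "x \<in> quot_space L W"
        unfolding quot_space_def quot_comb_def using rel_comb_in_W face_iff by blast
    qed
    show "quot_space L W \<subseteq> (\<Union>F\<in>reduced_complex k n. quot_cone L v F)"
      unfolding quot_space_def using cones_cover[OF P0] by blast
  qed
qed

text \<open>
  Three consecutive edges \<open>star 0\<close>, \<open>star a\<close>, \<open>star b\<close> of the star polygon have linearly independent
  forms, so their coefficients can be eliminated modulo the short rows. The other \<open>2 * k\<close> relevant
  edges form a face and hence give a basis.
\<close>

lemma quotient_dimension:
  assumes P0: "\<And>e. e \<in> rel \<Longrightarrow> h e (P0, 1) > 0"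
  shows "quot_has_dim L W (2 * k)"
proof -
  define a b where "a = k + 1" and "b = 2 * k + 2"
  define T where "T = {star 0, star a, star b}"
  define F where "F = rel - T"
  have Frel: "F \<subseteq> rel" by (auto simp: F_def)
  have ne: "star 0 \<noteq> star a" "star a \<noteq> star b" "star 0 \<noteq> star b"
    by (rule star_inj; use nk in \<open>simp add: a_def b_def\<close>)+
  then have "card T = 3" by (simp add: T_def)
  moreover have "card rel = n" using relevant_window[of 0] star_inj_on[of 0] by (simp add: card_image)
  moreover have "T \<subseteq> rel" by (simp add: T_def)
  ultimately have cF: "card F = 2 * k" using nk by (simp add: F_def card_Diff_subset finite_subset[OF _ finite_rel])
  have face: "F \<in> reduced_complex k n"
    unfolding face_iff
  proof (intro conjI allI notI)
    fix u assume u: "across u \<subseteq> F"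
    define w where "w = u mod n"
    have w: "w < n" "across w = across u" using n_ge across_mod by (simp_all add: w_def)
    have "w \<le> k \<or> k + 1 \<le> w \<and> w \<le> 2 * k + 1 \<or> w = 2 * k + 2" using w nk by linarith
    then have "a \<in> {w + 1..w + k + 1} \<or> b \<in> {w + 1..w + k + 1} \<or> 0 + n \<in> {w + 1..w + k + 1}"
      using nk by (auto simp: a_def b_def)
    then have "star a \<in> across w \<or> star b \<in> across w \<or> star (0 + n) \<in> across w"
      unfolding across_def by blast
    then have "across w \<inter> T \<noteq> {}" unfolding star_periodic T_def by blast
    then show False using u w by (auto simp: F_def)
  qed (rule Frel)
  have solve: "\<exists>p. h (star 0) p = r0 \<and> h (star a) p = ra \<and> h (star b) p = rb" for r0 ra rb
  proof -
    have v0: "h (star 0) (Q 0, 1) = 0" "h (star 0) (Q a, 1) = 0" "h (star a) (Q a, 1) = 0"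
      "h (star a) (Q b, 1) = 0" "h (star b) (Q b, 1) = 0"
      using h_endpoints(2)[of 0] h_endpoints(2)[of a] by (simp_all add: a_def b_def mult_2)
    have v1: "h (star 0) (Q b, 1) > 0"
      by (rule h_vertex_pos) (use nk in \<open>auto simp: b_def\<close>)
    have "h (star a) (Q (0 + n), 1) > 0" "h (star b) (Q (a + n), 1) > 0"
      by (rule h_vertex_pos; use nk in \<open>simp add: a_def b_def\<close>)+
    moreover have "vert (0 + n) = vert 0" "vert (a + n) = vert a" by (rule vert_periodic)+
    ultimately have v2: "h (star a) (Q 0, 1) > 0" "h (star b) (Q a, 1) > 0" by metis+
    define x where "x = ra / h (star a) (Q 0, 1)"
    define y where "y = r0 / h (star 0) (Q b, 1)"
    define z where "z = (rb - x * h (star b) (Q 0, 1)) / h (star b) (Q a, 1)"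
    \<comment> \<open>The values of the three forms at these three vertices form a triangular system.\<close>
    define p where "p = x *\<^sub>R (Q 0, 1) + y *\<^sub>R (Q b, 1) + z *\<^sub>R (Q a, 1 :: real)"
    have hp: "h e p = x * h e (Q 0, 1) + y * h e (Q b, 1) + z * h e (Q a, 1)" for e
      unfolding p_def by (simp only: h_linear_simps)
    have "h (star 0) p = r0" "h (star a) p = ra" "h (star b) p = rb"
      unfolding hp v0 using v1 v2 by (simp_all add: x_def y_def z_def)
    then show ?thesis by blast
  qed
  have reduce: "\<exists>d. x - (\<Sum>e\<in>F. d e *\<^sub>R v e) \<in> L" if x: "x \<in> W" for x
  proof -
    obtain c where c: "x - (\<Sum>e\<in>rel. c e *\<^sub>R v e) \<in> L" using W_mod_L[OF x] by blast
    obtain p where p: "h (star 0) p = - c (star 0) * \<bar>den (star 0)\<bar>"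
      "h (star a) p = - c (star a) * \<bar>den (star a)\<bar>" "h (star b) p = - c (star b) * \<bar>den (star b)\<bar>"
      using solve by blast
    define d where "d e = c e + h e p / \<bar>den e\<bar>" for e
    have "d e = 0" if "e \<in> T" for e
      using that p den_pos[of "star 0"] den_pos[of "star a"] den_pos[of "star b"] by (auto simp: T_def d_def)
    then have dF: "(\<Sum>e\<in>F. d e *\<^sub>R v e) = (\<Sum>e\<in>rel. d e *\<^sub>R v e)"
      by (intro sum.mono_neutral_left) (use finite_rel in \<open>auto simp: F_def\<close>)
    have "x - (\<Sum>e\<in>F. d e *\<^sub>R v e) \<in> L"
      unfolding dF unfolding d_def by (rule shift_coefficients[OF c])
    then show ?thesis by blast
  qed
  have "finite F" using finite_subset[OF Frel finite_rel] .
  then obtain \<beta> where \<beta>: "bij_betw \<beta> {..<2 * k} F"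
    using ex_bij_betw_nat_finite[of F] cF by (metis atLeast0LessThan)
  have comb: "quot_comb L (v \<circ> \<beta>) c {..<2 * k} = quot_comb L v (c \<circ> inv_into {..<2 * k} \<beta>) F" for c
  proof -
    have "(\<Sum>i<2 * k. c i *\<^sub>R (v \<circ> \<beta>) i) =
        (\<Sum>i<2 * k. (c \<circ> inv_into {..<2 * k} \<beta>) (\<beta> i) *\<^sub>R v (\<beta> i))"
      using \<beta> by (intro sum.cong) (auto simp: bij_betw_def)
    also have "\<dots> = (\<Sum>e\<in>F. (c \<circ> inv_into {..<2 * k} \<beta>) e *\<^sub>R v e)"
      by (rule sum.reindex_bij_betw[OF \<beta>])
    finally show ?thesis by (simp add: quot_comb_def)
  qed
  have comb': "quot_comb L v d F = quot_comb L (v \<circ> \<beta>) (d \<circ> \<beta>) {..<2 * k}" for d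
    using sum.reindex_bij_betw[OF \<beta>, of "\<lambda>e. d e *\<^sub>R v e"] by (simp add: quot_comb_def)
  show ?thesis
    unfolding quot_has_dim_def
  proof (intro exI[of _ "v \<circ> \<beta>"] conjI allI impI)
    fix i assume "i < 2 * k"
    then have "\<beta> i \<in> all_edges n" using \<beta> Frel rel_subset_all by (auto simp: bij_betw_def)
    then show "(v \<circ> \<beta>) i \<in> W" by (simp add: span_base)
  next
    have "quot_independent L v F" by (rule face_independent[OF P0 face])
    then show "quot_independent L (v \<circ> \<beta>) {..<2 * k}"
      unfolding quot_independent_def comb
      using \<beta> by (auto simp: bij_betw_def)
  next
    show "quot_space L W = {quot_comb L (v \<circ> \<beta>) c {..<2 * k} | c. True}"
    proof (intro equalityI subsetI)
      fix x assume "x \<in> quot_space L W"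
      then obtain y where y: "y \<in> W" "x = coset L y" by (auto simp: quot_space_def)
      obtain d where "y - (\<Sum>e\<in>F. d e *\<^sub>R v e) \<in> L" using reduce y by blast
      then have "x = quot_comb L v d F" unfolding y quot_comb_def coset_eq_iff[OF subspace_L] .
      then show "x \<in> {quot_comb L (v \<circ> \<beta>) c {..<2 * k} | c. True}" unfolding comb' by blast
    next
      fix x assume "x \<in> {quot_comb L (v \<circ> \<beta>) c {..<2 * k} | c. True}"
      then obtain c where "x = quot_comb L v c F" unfolding comb by blast
      then show "x \<in> quot_space L W"
        unfolding quot_space_def quot_comb_def using rel_comb_in_W[OF Frel] by blast
    qed
  qed
qed

text \<open>
  The class of minus the sum of all relevant rows lies in some cone; moving everything to one side
  gives a dependence with all coefficients positive.
\<close>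

lemma point_if_fan:
  assumes "complete_simplicial_fan L W v (reduced_complex k n)"
  shows "\<exists>P. \<forall>e\<in>rel. h e (P, 1) > 0"
proof -
  have "coset L (- (\<Sum>e\<in>rel. 1 *\<^sub>R v e)) \<in> quot_space L W"
    unfolding quot_space_def by (intro imageI span_neg rel_comb_in_W) simp
  moreover have "(\<Union>F\<in>reduced_complex k n. quot_cone L v F) = quot_space L W"
    using assms unfolding complete_simplicial_fan_def by (elim conjE)
  ultimately have "coset L (- (\<Sum>e\<in>rel. 1 *\<^sub>R v e)) \<in> (\<Union>F\<in>reduced_complex k n. quot_cone L v F)"
    by simp
  then obtain F where "F \<in> reduced_complex k n" "coset L (- (\<Sum>e\<in>rel. 1 *\<^sub>R v e)) \<in> quot_cone L v F"
    by (rule UN_E)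
  then obtain c where F: "F \<in> reduced_complex k n" "\<forall>e\<in>F. 0 \<le> c e"
    "coset L (- (\<Sum>e\<in>rel. 1 *\<^sub>R v e)) = coset L (\<Sum>e\<in>F. c e *\<^sub>R v e)"
    unfolding quot_cone_def quot_comb_def mem_Collect_eq by (elim exE conjE)
  have Frel: "F \<subseteq> rel" using F face_iff by blast
  have "(\<Sum>e\<in>F. c e *\<^sub>R v e) - (- (\<Sum>e\<in>rel. 1 *\<^sub>R v e)) \<in> L"
    using F(3)[symmetric] unfolding coset_eq_iff[OF subspace_L] .
  then have "(\<Sum>e\<in>rel. ((if e \<in> F then c e else 0) + 1) *\<^sub>R v e) \<in> L"
    unfolding sum_extend[OF Frel] scaleR_add_left sum.distrib by simp
  then obtain p where p: "\<forall>e\<in>rel. (if e \<in> F then c e else 0) + 1 = h e p / \<bar>den e\<bar>"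
    unfolding relevant_dependence_iff by blast
  have pos: "h e p > 0" if e: "e \<in> rel" for e
  proof -
    have "h e p / \<bar>den e\<bar> > 0"
      using p e F(2) by (metis add_nonneg_pos order_refl zero_less_one)
    then show ?thesis using den_pos[OF e] by (simp add: zero_less_divide_iff)
  qed
  have w: "snd p > 0" by (rule positive_imp_affine[OF pos])
  have "h e ((1 / snd p) *\<^sub>R fst p, 1) > 0" if e: "e \<in> rel" for e
  proof -
    have "((1 / snd p) *\<^sub>R fst p, 1) = (1 / snd p) *\<^sub>R p" using w by (simp add: prod_eq_iff)
    then have "h e ((1 / snd p) *\<^sub>R fst p, 1) = (1 / snd p) * h e p" by (simp only: h_linear_simps)
    then show ?thesis using w pos[OF e] by simp
  qed
  then show ?thesis by blast
qed

lemma fan_iff_all_meet: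
  "realizes_complete_fan k n v \<longleftrightarrow> (\<Inter>e\<in>rel. big_half_plane k q e) \<noteq> {}"
proof -
  have dim: "k * (n - 2 * k - 1) = 2 * k" by (simp add: n_def)
  have "realizes_complete_fan k n v \<longleftrightarrow>
      quot_has_dim L W (2 * k) \<and> complete_simplicial_fan L W v (reduced_complex k n)"
    unfolding realizes_complete_fan_def Let_def dim by (rule refl)
  also have "\<dots> \<longleftrightarrow> (\<exists>P. \<forall>e\<in>rel. h e (P, 1) > 0)"
    using quotient_dimension fan_if_point point_if_fan by blast
  also have "\<dots> \<longleftrightarrow> (\<Inter>e\<in>rel. big_half_plane k q e) \<noteq> {}"
    using big_half_plane_eq by fastforce
  finally show ?thesis .
qed

end

section \<open>The equivalence\<close>

theorem theorem3p15:
  fixes k :: nat and q :: "nat \<Rightarrow> real \<times> real"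
  assumes "k \<ge> 1" and "convex_position (2*k+3) q"
  shows "(realizes_complete_fan k (2*k+3) (C_row (2*k) q) \<longleftrightarrow>
           (\<forall>T. octahedral k T \<longrightarrow>
              (\<Inter>e \<in> all_edges (2*k+3) - T. big_half_plane k q e) \<noteq> {})) \<and>
         ((\<forall>T. octahedral k T \<longrightarrow>
              (\<Inter>e \<in> all_edges (2*k+3) - T. big_half_plane k q e) \<noteq> {}) \<longleftrightarrow>
           (\<Inter>e \<in> relevant_edges k (2*k+3). big_half_plane k q e) \<noteq> {})"
proof -
  have "2 * k + 3 \<ge> 3" by simp
  from convex_position_oriented[OF assms(2) this] obtain s :: real where s: "s * s = 1"
    "\<And>i j l. 1 \<le> i \<Longrightarrow> i < j \<Longrightarrow> j < l \<Longrightarrow> l \<le> 2*k+3 \<Longrightarrow> s * orient (q i) (q j) (q l) > 0"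
    by blast
  interpret star_polygon k "2*k+3" q s
    by unfold_locales (use assms(1) s in auto)
  show ?thesis using fan_iff_all_meet octahedral_iff_all_meet by simp
qed

end
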